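(* Let $\mathcal{H}(x)=\sum_{n\leqslant x}2\uparrow\uparrow H(n)$. Then for $x\geqslant 2$, $$\mathcal{H}(x)=\frac{x\log^*x}{2}+c_1x+H_1(x)+O\!\left(x^{1/2}(\log x)^{9/4}\right),$$ where $c_1=\sum_{k=1}^{\infty}\left((2\uparrow\uparrow k)\mathcal{D}_k-\tfrac12\right)=1.813\ldots$ and $H_1(x)=(2\uparrow\uparrow \log^*x)\left(\mathcal{D}_{\log^*x}(x)-x\,\mathcal{D}_{\log^*x}\right)$. Moreover: (i) $H_1(x)\ll x$; (ii) $H_1(x)\ll x^{1/2}(\log x)^{9/4}$ if $x=(2\uparrow\uparrow N)-1$ for some natural $N$; (iii) $H_1(x)=x/2+O(x^{\Delta})$ with $\Delta=2-\frac{\log 3}{\log 2}=0.41503\ldots$, if $x=2\uparrow\uparrow N$ for some natural $N$.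
   Context: For a natural number $n$, $H(n)$ is the height of its factorization tree: $H(1)=0$ and, for $n=p_1^{\alpha_1}\cdots p_k^{\alpha_k}>1$ with distinct primes $p_i$, $H(n)=1+\max_i H(\alpha_i)$. Tetration: $a\uparrow\uparrow 0=1$, $a\uparrow\uparrow b=a^{a\uparrow\uparrow(b-1)}$ for $b\geqslant1$. For $x\geqslant 2$, $\log^*x$ is the integer $m\geqslant1$ with $2\uparrow\uparrow m\leqslant x<2\uparrow\uparrow(m+1)$. For $k\geqslant1$, $\mathcal{D}_k(x)=\#\{n\leqslant x:H(n)=k\}$ and $\mathcal{D}_k=\lim_{x\to\infty}\mathcal{D}_k(x)/x$ (the natural density of $\{n:H(n)=k\}$, which exists). *)

theory Defs
  imports "HOL-Analysis.Analysis" "HOL-Computational_Algebra.Primes"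
begin

lemma multiplicity_less_self:
  assumes "prime (p::nat)" "n > 0"
  shows "multiplicity p n < n"
proof -
  have "p ^ multiplicity p n dvd n" by (rule multiplicity_dvd)
  hence "p ^ multiplicity p n \<le> n" using assms(2) by (simp add: dvd_imp_le)
  moreover have "multiplicity p n < p ^ multiplicity p n"
    proof -
    have "multiplicity p n < 2 ^ multiplicity p n" by (rule less_exp)
    also have "\<dots> \<le> p ^ multiplicity p n"
      using prime_ge_2_nat[OF assms(1)] by (rule power_mono) simp
    finally show ?thesis .
  qed
  ultimately show ?thesis by linarith
qed

text \<open>Height of the factorization tree; H 1 = 0 (value at 0 irrelevant, set to 0).\<close>
function H :: "nat \<Rightarrow> nat" where
  "H n = (if n \<le> 1 then 0 else 1 + Max ((\<lambda>p. H (multiplicity p n)) ` prime_factors n))"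
  by auto
termination
  by (relation "Wellfounded.measure id") (auto intro: multiplicity_less_self)

declare H.simps [simp del]

fun tet :: "nat \<Rightarrow> nat \<Rightarrow> nat" where
  "tet a 0 = 1"
| "tet a (Suc b) = a ^ tet a b"

definition logstar :: "real \<Rightarrow> nat" where
  "logstar x = (THE m. 1 \<le> m \<and> real (tet 2 m) \<le> x \<and> x < real (tet 2 (m + 1)))"

definition Dcount :: "nat \<Rightarrow> real \<Rightarrow> real" where
  "Dcount k x = real (card {n::nat. 1 \<le> n \<and> real n \<le> x \<and> H n = k})"

definition Ddens :: "nat \<Rightarrow> real" where
  "Ddens k = Lim at_top (\<lambda>x::real. Dcount k x / x)"

definition calH :: "real \<Rightarrow> real" where
  "calH x = (\<Sum>n\<in>{n::nat. 1 \<le> n \<and> real n \<le> x}. real (tet 2 (H n)))"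

definition c1 :: real where
  "c1 = (\<Sum>k. real (tet 2 (Suc k)) * Ddens (Suc k) - 1/2)"

definition H1 :: "real \<Rightarrow> real" where
  "H1 x = real (tet 2 (logstar x)) * (Dcount (logstar x) x - x * Ddens (logstar x))"

end

theory Submission
  imports Defs "HOL-Computational_Algebra.Squarefree"
begin

text \<open>
  Whether \<open>H n \<le> k\<close> holds is decided by the exponents of \<open>n\<close>, each of which must have height less than
  \<open>k\<close>. The indicator of this condition is the Dirichlet convolution of \<open>1\<close> with a function that is
  bounded by \<open>1\<close> and supported on squareful numbers, so \<open>{n \<le> x. H n \<le> k}\<close> has \<open>x P\<^sub>k + O(x\<^bsup>1/2\<^esup>)\<close>
  elements uniformly in \<open>k\<close>, with \<open>P\<^sub>k\<close> being \<open>Hdens k\<close>.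
  In \<open>\<H>(x)\<close> the weights of the levels below \<open>L = log\<^sup>* x\<close> add up to
  \<open>O(log x)\<close>, so those levels contribute their main terms, and level \<open>L\<close> contributes \<open>H\<^sub>1(x)\<close> in addition.

  A number of height greater than \<open>k\<close> typically has it because \<open>2\<close> occurs with exponent exactly
  \<open>T = 2\<up>\<up>k\<close>; the next possible exponent is at least \<open>2 T\<close>, and the next prime contributes a relative
  \<open>(2/3)\<^bsup>T\<^esup>\<close>. Hence \<open>(2\<up>\<up>(k+1)) D\<^sub>k\<^sub>+\<^sub>1 = 1/2 + O((2/3)\<^bsup>T\<^esup>)\<close>. With \<open>x < 2\<^bsup>T\<^esup>\<close> for \<open>k = L\<close> the tail of the
  series for \<open>c\<^sub>1\<close> is \<open>O(x\<^bsup>\<Delta>-1\<^esup>)\<close>.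

  Telescoping gives \<open>c\<^sub>1 = 2 - 2 P\<^sub>1 + 12 (1 - P\<^sub>2) + 65520 (1 - P\<^sub>3)\<close> up to a negligible amount, where
  \<open>P\<^sub>1 = 6 / \<pi>\<^sup>2\<close>, and \<open>P\<^sub>2\<close> is enclosed by sieving with the primes below \<open>61\<close>, whose exponents are
  independent.
\<close>

section \<open>Heights and tetration\<close>

lemma H_0 [simp]: "H 0 = 0"
  by (simp add: H.simps)

lemma H_1 [simp]: "H (Suc 0) = 0"
  by (simp add: H.simps)

text \<open>The maximum over prime factors extends to all primes because a prime not dividing
  \<open>n\<close> has exponent 0 and \<open>H 0 = 0 < k\<close>. For \<open>k = 0\<close> the right
  side would also hold for \<open>n = 1\<close>, whose height is 0.\<close>

lemma Suc_le_H_iff: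
  assumes "n > 0" "k > 0"
  shows "Suc k \<le> H n \<longleftrightarrow> (\<exists>p. prime p \<and> k \<le> H (multiplicity p n))"
proof (cases "n = 1")
  case True
  then show ?thesis using assms by auto
next
  case False
  with assms have n: "n > 1" by simp
  have ne: "prime_factors n \<noteq> {}"
    using n prime_factorization_empty_iff[of n] by auto
  have "Suc k \<le> H n \<longleftrightarrow> k \<le> Max ((\<lambda>p. H (multiplicity p n)) ` prime_factors n)"
    using n by (subst H.simps) auto
  also have "\<dots> \<longleftrightarrow> (\<exists>p\<in>prime_factors n. k \<le> H (multiplicity p n))"
    using ne by (subst Max_ge_iff) auto
  also have "\<dots> \<longleftrightarrow> (\<exists>p. prime p \<and> k \<le> H (multiplicity p n))"
  proof
    assume "\<exists>p. prime p \<and> k \<le> H (multiplicity p n)"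
    then obtain p where p: "prime p" "k \<le> H (multiplicity p n)" by blast
    with assms(2) have "multiplicity p n \<noteq> 0" by (metis H_0 le_zero_eq neq0_conv)
    then have "p dvd n" by (metis not_dvd_imp_multiplicity_0)
    with p n show "\<exists>p\<in>prime_factors n. k \<le> H (multiplicity p n)"
      by (intro bexI[of _ p] prime_factorsI) auto
  qed auto
  finally show ?thesis .
qed

lemma H_le_Suc_iff:
  assumes "n > 0"
  shows "H n \<le> Suc k \<longleftrightarrow> (\<forall>p. prime p \<longrightarrow> H (multiplicity p n) \<le> k)"
  using Suc_le_H_iff[of n "Suc k"] assms by (auto simp: not_less_eq_eq)

lemma H_pos_iff: "H n > 0 \<longleftrightarrow> n > 1"
  by (subst H.simps) auto

lemma H_le_1_iff_squarefree:
  assumes "n > 0"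
  shows "H n \<le> 1 \<longleftrightarrow> squarefree n"
proof -
  have "H n \<le> 1 \<longleftrightarrow> (\<forall>p. prime p \<longrightarrow> multiplicity p n \<le> 1)"
  proof -
    have "H a \<le> 0 \<longleftrightarrow> a \<le> 1" for a using H_pos_iff[of a] by linarith
    then show ?thesis using H_le_Suc_iff[OF assms, of 0] by simp
  qed
  also have "\<dots> \<longleftrightarrow> squarefree n"
    using assms squarefree_factorial_semiring''[of n] by auto
  finally show ?thesis .
qed

section \<open>Tetration and the least number of each height\<close>

lemma strict_mono_tet: "strict_mono (tet 2)"
  by (rule strict_monoI_Suc) simp

lemma tet_mono: "i \<le> j \<Longrightarrow> tet 2 i \<le> tet 2 j"
  using strict_mono_tet by (simp add: strict_mono_less_eq)

lemma tet_pos [simp]: "tet 2 k > 0"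
  by (induction k) auto

text \<open>Linear growth of tetration is enough twice: to dominate the tail of the series for
  \<open>c1\<close> by a geometric series, and to show that \<open>tet 2\<close> is
  unbounded.\<close>

lemma tet_add_le: "tet 2 k + i \<le> tet 2 (k + i)"
proof (induction i)
  case (Suc i)
  have "tet 2 (k + i) < tet 2 (k + Suc i)"
    using strict_mono_tet by (simp add: strict_mono_less del: tet.simps)
  with Suc show ?case by linarith
qed simp

text \<open>For height above 1, some exponent of \<open>n\<close> has height at least
  \<open>H n - 1\<close>, so by induction it is at least \<open>tet 2 (H n - 1)\<close>, and its
  prime is at least 2. Together with \<open>H_tet\<close>, \<open>tet 2 k\<close> is the least
  positive number of height \<open>k\<close>.\<close>

lemma tet_H_le: "n > 0 \<Longrightarrow> tet 2 (H n) \<le> n"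
proof (induction n rule: less_induct)
  case (less n)
  show ?case
  proof (cases "H n")
    case (Suc j)
    show ?thesis
    proof (cases "j = 0")
      case True
      then show ?thesis using Suc H_pos_iff[of n] by simp
    next
      case False
      then obtain p where p: "prime p" "j \<le> H (multiplicity p n)"
        using Suc_le_H_iff[of n j] Suc less.prems by auto
      define m where "m = multiplicity p n"
      have m: "m > 0" using p False unfolding m_def by (metis H_0 le_zero_eq neq0_conv)
      have "m < n" unfolding m_def using p less.prems multiplicity_less_self by blast
      with m have "tet 2 (H m) \<le> m" using less.IH by blast
      then have "tet 2 j \<le> m" using p(2) tet_mono[of j "H m"] m_def order_trans by blast
      then have "2 ^ tet 2 j \<le> (2::nat) ^ m" by simp
      also have "\<dots> \<le> p ^ m" using prime_ge_2_nat[OF p(1)] by (rule power_mono) simp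
      also have "\<dots> \<le> n" unfolding m_def using less.prems
        by (simp add: multiplicity_dvd dvd_imp_le)
      finally show ?thesis using Suc by simp
    qed
  qed (use less in auto)
qed

lemma tet_le_of_le_H: "n > 0 \<Longrightarrow> k \<le> H n \<Longrightarrow> tet 2 k \<le> n"
  using tet_H_le[of n] tet_mono[of k "H n"] by linarith

lemma H_tet [simp]: "H (tet 2 k) = k"
proof (induction k)
  case (Suc k)
  have "prime_factors ((2::nat) ^ tet 2 k) = {2}"
    by (simp add: prime_factorization_prime_power)
  moreover have "(2::nat) ^ tet 2 k > 1" by (rule one_less_power) auto
  moreover have "multiplicity 2 ((2::nat) ^ tet 2 k) = tet 2 k" by simp
  ultimately show ?case using Suc by (subst H.simps) auto
qed simp

text \<open>With \<open>k = Suc j\<close>, some prime \<open>q\<close> occurs in \<open>a\<close>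
  with exponent at least \<open>tet 2 j\<close>. For \<open>q = 2\<close> this makes
  \<open>a\<close> a multiple of \<open>tet 2 k\<close>; for larger \<open>q\<close> already
  \<open>3 ^ tet 2 j\<close> is at least \<open>2 * tet 2 k\<close>. For \<open>k = 1\<close> the
  claim fails at \<open>a = 3\<close>.\<close>

lemma two_tet_le:
  assumes "k \<ge> 2" "k \<le> H a" "a \<noteq> tet 2 k"
  shows "2 * tet 2 k \<le> a"
proof -
  obtain j where k: "k = Suc j" "j > 0" using assms(1) by (cases k) auto
  have a: "a > 0" using assms by (cases a) auto
  obtain q where q: "prime q" "j \<le> H (multiplicity q a)"
    using Suc_le_H_iff[of a j] a k assms by auto
  have "multiplicity q a > 0" using q k by (metis H_0 le_zero_eq neq0_conv)
  then have "tet 2 j \<le> multiplicity q a" using q tet_le_of_le_H by blast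
  then have dvd: "q ^ tet 2 j dvd a" by (rule multiplicity_dvd')
  show ?thesis
  proof (cases "q = 2")
    case True
    then obtain c where c: "a = tet 2 k * c" using dvd k by auto
    with assms(3) a have "c \<noteq> 1" "c \<noteq> 0" by auto
    then have "c \<ge> 2" by simp
    then have "tet 2 k * 2 \<le> tet 2 k * c" by (rule mult_le_mono2)
    then show ?thesis using c by simp
  next
    case False
    then have q3: "q \<ge> 3" using prime_ge_2_nat[OF q(1)] by simp
    have "tet 2 1 \<le> tet 2 j" by (rule tet_mono) (use k in simp)
    then obtain i where i: "tet 2 j = i + 2" by (metis One_nat_def le_add_diff_inverse2 power_one_right tet.simps)
    \<comment> \<open>This is \<open>8 * 2 ^ i <= 9 * 3 ^ i\<close>; hence the exponent was written
      as \<open>i + 2\<close>.\<close>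
    have "2 * (2::nat) ^ (i + 2) \<le> 3 ^ (i + 2)"
    proof -
      have "(2::nat) ^ i \<le> 3 ^ i" by (rule power_mono) auto
      then show ?thesis by simp
    qed
    also have "\<dots> \<le> q ^ (i + 2)" using q3 by (rule power_mono) simp
    also have "\<dots> \<le> a" using dvd a i by (auto dest: dvd_imp_le)
    finally show ?thesis using k i by simp
  qed
qed

section \<open>Counting integers with prescribed prime exponents\<close>

definition exps_in :: "(nat \<Rightarrow> bool) \<Rightarrow> nat \<Rightarrow> bool" where
  "exps_in h n \<longleftrightarrow> (\<forall>p. prime p \<longrightarrow> h (multiplicity p n))"

text \<open>The Moebius transform in a single exponent: when \<open>h 0\<close> holds, its partial
  sums telescope to the indicator of \<open>h\<close>. Exponent 0 is separate because
  \<open>a - 1\<close> truncates there and the difference would be 0.\<close>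

definition exp_jump :: "(nat \<Rightarrow> bool) \<Rightarrow> nat \<Rightarrow> real" where
  "exp_jump h a = (if a = 0 then 1 else of_bool (h a) - of_bool (h (a - 1)))"

text \<open>The Dirichlet convolution of the indicator of \<^const>\<open>exps_in\<close> with the Moebius function.\<close>

definition exps_moebius :: "(nat \<Rightarrow> bool) \<Rightarrow> nat \<Rightarrow> real" where
  "exps_moebius h n = (\<Prod>p\<in>prime_factors n. exp_jump h (multiplicity p n))"

lemma sum_exp_jump:
  assumes "h 0"
  shows "(\<Sum>i\<le>a. exp_jump h i) = of_bool (h a)"
  by (induction a) (auto simp: exp_jump_def assms)

lemma exps_moebius_prime_power_mult:
  assumes p: "prime p" "\<not> p dvd e" and e: "e > 0"
  shows "exps_moebius h (p ^ i * e) = exp_jump h i * exps_moebius h e"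
proof -
  \<comment> \<open>For \<open>i = 0\<close> the prime \<open>p\<close> is not a factor of the
    product. Over the larger set \<open>?S\<close> such a prime contributes
    \<open>exp_jump h 0 = 1\<close>, so no case distinction on \<open>i\<close> arises.\<close>
  let ?S = "insert p (prime_factors e)"
  have p_notin: "p \<notin> prime_factors e" using p by auto
  have "exps_moebius h (p ^ i * e) = (\<Prod>q\<in>?S. exp_jump h (multiplicity q (p ^ i * e)))"
    unfolding exps_moebius_def
  proof (rule prod.mono_neutral_left)
    show "prime_factors (p ^ i * e) \<subseteq> ?S"
    proof
      fix q assume q: "q \<in> prime_factors (p ^ i * e)"
      then have "prime q" "q dvd p ^ i * e" by auto
      then have "q dvd p ^ i \<or> q dvd e" by (simp add: prime_dvd_mult_iff)
      then show "q \<in> ?S"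
        using \<open>prime q\<close> p e by (metis insert_iff prime_dvd_power primes_dvd_imp_eq prime_factorsI neq0_conv)
    qed
    show "\<forall>q\<in>?S - prime_factors (p ^ i * e). exp_jump h (multiplicity q (p ^ i * e)) = 1"
    proof
      fix q assume q: "q \<in> ?S - prime_factors (p ^ i * e)"
      then have "prime q" using p by auto
      then have "\<not> q dvd p ^ i * e"
        using q e p by (metis DiffD2 no_zero_divisors not_gr_zero power_eq_0_iff prime_factorsI not_prime_0)
      then show "exp_jump h (multiplicity q (p ^ i * e)) = 1"
        by (simp add: not_dvd_imp_multiplicity_0 exp_jump_def)
    qed
  qed auto
  also have "\<dots> = exp_jump h (multiplicity p (p ^ i * e)) *
                   (\<Prod>q\<in>prime_factors e. exp_jump h (multiplicity q (p ^ i * e)))"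
    using p_notin by simp
  also have "multiplicity p (p ^ i * e) = i"
    using p e by (simp add: prime_elem_multiplicity_mult_distrib not_dvd_imp_multiplicity_0)
  also have "(\<Prod>q\<in>prime_factors e. exp_jump h (multiplicity q (p ^ i * e))) = exps_moebius h e"
    unfolding exps_moebius_def
  proof (rule prod.cong)
    fix q assume q: "q \<in> prime_factors e"
    then have "prime q" "q \<noteq> p" using p by auto
    then show "exp_jump h (multiplicity q (p ^ i * e)) = exp_jump h (multiplicity q e)"
      using p e by (simp add: prime_elem_multiplicity_mult_distrib multiplicity_distinct_prime_power)
  qed simp
  finally show ?thesis .
qed

lemma divisors_prime_power_mult:
  fixes p m :: nat
  assumes p: "prime p" "\<not> p dvd m" and m: "m > 0"
  shows "{d. d dvd p ^ a * m} = (\<lambda>(i, e). p ^ i * e) ` ({..a} \<times> {e. e dvd m})"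
    and "inj_on (\<lambda>(i, e). p ^ i * e) ({..a} \<times> {e. e dvd m})"
proof -
  show "{d. d dvd p ^ a * m} = (\<lambda>(i, e). p ^ i * e) ` ({..a} \<times> {e. e dvd m})"
  proof (intro equalityI subsetI)
    fix d assume "d \<in> {d. d dvd p ^ a * m}"
    then have d: "d dvd p ^ a * m" by simp
    have pm: "p ^ a * m \<noteq> 0" using p m by auto
    with d have d0: "d \<noteq> 0" by (metis dvd_0_left)
    obtain e where e: "d = p ^ multiplicity p d * e" "\<not> p dvd e"
      using multiplicity_decompose'[of d p] d0 p by (metis not_prime_unit)
    have "multiplicity p d \<le> multiplicity p (p ^ a * m)"
      using d pm by (rule dvd_imp_multiplicity_le)
    also have "\<dots> = a"
      using p m by (simp add: prime_elem_multiplicity_mult_distrib not_dvd_imp_multiplicity_0)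
    finally have le: "multiplicity p d \<le> a" .
    have "e dvd p ^ a * m" using d e by (metis dvd_mult_right)
    moreover have "coprime e (p ^ a)"
      using p e by (metis coprime_commute coprime_power_right_iff prime_imp_coprime)
    ultimately have "e dvd m" by (simp add: coprime_dvd_mult_right_iff)
    with le e show "d \<in> (\<lambda>(i, e). p ^ i * e) ` ({..a} \<times> {e. e dvd m})"
      by (intro image_eqI[where x = "(multiplicity p d, e)"]) auto
  next
    fix d assume "d \<in> (\<lambda>(i, e). p ^ i * e) ` ({..a} \<times> {e. e dvd m})"
    then show "d \<in> {d. d dvd p ^ a * m}" by (auto intro: mult_dvd_mono le_imp_power_dvd)
  qed
  show "inj_on (\<lambda>(i, e). p ^ i * e) ({..a} \<times> {e. e dvd m})"
  proof (rule inj_onI, clarsimp)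
    fix i e j f assume H: "e dvd m" "f dvd m" "p ^ i * e = p ^ j * f"
    have *: "multiplicity p (p ^ l * g) = l" if "g dvd m" for l g
    proof -
      have "\<not> p dvd g" using that p dvd_trans by blast
      moreover have "g \<noteq> 0" using that m by auto
      ultimately show ?thesis using p
        by (simp add: prime_elem_multiplicity_mult_distrib not_dvd_imp_multiplicity_0)
    qed
    have "i = j" using *[OF H(1), of i] *[OF H(2), of j] H(3) by simp
    with H(3) p show "i = j \<and> e = f" by auto
  qed
qed

text \<open>Splitting off the full power of one prime \<open>p\<close> factors the divisor sum; the
  sum over the powers of \<open>p\<close> telescopes to the indicator of \<open>h\<close> at the
  exponent of \<open>p\<close>, and induction covers the cofactor.\<close>

lemma sum_divisors_exps_moebius:
  assumes "n > 0" "h 0"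
  shows "(\<Sum>d | d dvd n. exps_moebius h d) = of_bool (exps_in h n)"
  using assms(1)
proof (induction n rule: less_induct)
  case (less n)
  show ?case
  proof (cases "n = 1")
    case True
    then show ?thesis using assms(2) by (simp add: exps_moebius_def exps_in_def)
  next
    case False
    then obtain p where p: "prime p" "p dvd n" using prime_factor_nat by blast
    define a where "a = multiplicity p n"
    obtain m where m: "n = p ^ a * m" "\<not> p dvd m"
      using multiplicity_decompose'[of n p] less.prems p unfolding a_def
      by (metis neq0_conv not_prime_unit)
    have m0: "m > 0" using m less.prems by (cases m) auto
    have "a > 0" using p less.prems unfolding a_def by (simp add: prime_multiplicity_gt_zero_iff)
    then have "p ^ a > 1" using prime_gt_1_nat[OF p(1)] by (rule one_less_power[rotated])
    then have "m < n" using m m0 by simp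
    then have IH: "(\<Sum>d | d dvd m. exps_moebius h d) = of_bool (exps_in h m)"
      using less.IH m0 by blast
    have fin: "finite {e. e dvd m}" using m0 by simp
    have "(\<Sum>d | d dvd n. exps_moebius h d) =
          (\<Sum>(i, e)\<in>{..a} \<times> {e. e dvd m}. exps_moebius h (p ^ i * e))"
      unfolding m(1) divisors_prime_power_mult(1)[OF p(1) m(2) m0]
      by (subst sum.reindex[OF divisors_prime_power_mult(2)[OF p(1) m(2) m0]])
        (simp add: case_prod_unfold)
    also have "\<dots> = (\<Sum>(i, e)\<in>{..a} \<times> {e. e dvd m}. exp_jump h i * exps_moebius h e)"
    proof (rule sum.cong)
      fix z assume z: "z \<in> {..a} \<times> {e. e dvd m}"
      obtain i e where ie: "z = (i, e)" by (cases z)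
      have "e dvd m" using z ie by auto
      then have "\<not> p dvd e" "e > 0" using m m0 dvd_trans by (blast, auto intro: Nat.gr0I)
      then show "(case z of (i, e) \<Rightarrow> exps_moebius h (p ^ i * e)) =
                 (case z of (i, e) \<Rightarrow> exp_jump h i * exps_moebius h e)"
        using exps_moebius_prime_power_mult[OF p(1)] ie by simp
    qed simp
    also have "\<dots> = (\<Sum>i\<le>a. exp_jump h i) * (\<Sum>e | e dvd m. exps_moebius h e)"
      by (simp add: sum_product sum.cartesian_product)
    also have "\<dots> = of_bool (h a \<and> exps_in h m)"
      using IH sum_exp_jump[of h a] assms(2) by simp
    also have "h a \<and> exps_in h m \<longleftrightarrow> exps_in h n"
    proof -
      have mm: "multiplicity p m = 0" using m by (simp add: not_dvd_imp_multiplicity_0)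
      have "multiplicity q n = multiplicity q m" if "prime q" "q \<noteq> p" for q
        using that p m m0
        by (simp add: prime_elem_multiplicity_mult_distrib multiplicity_distinct_prime_power)
      then show ?thesis unfolding exps_in_def using mm assms(2) p(1)
        by (metis a_def)
    qed
    finally show ?thesis .
  qed
qed

lemma abs_exps_moebius_le: "\<bar>exps_moebius h n\<bar> \<le> 1"
proof -
  have "\<bar>exps_moebius h n\<bar> = (\<Prod>p\<in>prime_factors n. \<bar>exp_jump h (multiplicity p n)\<bar>)"
    unfolding exps_moebius_def by (simp add: abs_prod)
  also have "\<dots> \<le> 1" by (rule prod_le_1) (auto simp: exp_jump_def)
  finally show ?thesis .
qed

section \<open>Squareful numbers and the error term\<close>

definition squareful :: "nat \<Rightarrow> bool" where
  "squareful n \<longleftrightarrow> n > 0 \<and> (\<forall>p. prime p \<longrightarrow> p dvd n \<longrightarrow> p ^ 2 dvd n)"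

text \<open>If \<open>h\<close> holds at 0 and 1, then \<open>exp_jump h 1 = 0\<close>, so a prime
  occurring exactly once makes the product vanish.\<close>

lemma squareful_if_exps_moebius_nonzero:
  assumes "h 0" "h 1" "n > 0" "exps_moebius h n \<noteq> 0"
  shows "squareful n"
  unfolding squareful_def
proof (intro conjI allI impI)
  fix p :: nat assume p: "prime p" "p dvd n"
  then have pn: "p \<in> prime_factors n" using assms by (auto intro: prime_factorsI)
  have "exp_jump h (multiplicity p n) \<noteq> 0"
    using assms(4) pn unfolding exps_moebius_def by auto
  then have "multiplicity p n \<noteq> 1" using assms by (auto simp: exp_jump_def)
  moreover have "multiplicity p n > 0" using p assms by (simp add: prime_multiplicity_gt_zero_iff)
  ultimately show "p ^ 2 dvd n" by (intro multiplicity_dvd') simp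
qed (use assms in simp)

text \<open>In \<open>n = s * q ^ 2\<close> with \<open>s\<close> squarefree, every prime dividing
  \<open>s\<close> divides \<open>q\<close>, since its square divides \<open>n\<close>. Hence
  \<open>q = s * a\<close>, and \<open>b = s\<close> serves as the base of the cube.\<close>

lemma squareful_decompose:
  assumes "squareful n"
  obtains a b where "a > 0" "b > 0" "n = a ^ 2 * b ^ 3"
proof -
  have n: "n > 0" using assms squareful_def by auto
  define s q where "s = squarefree_part n" and "q = square_part n"
  have nsq: "n = s * q ^ 2" unfolding s_def q_def by (rule squarefree_decompose)
  have s0: "s \<noteq> 0" and q0: "q \<noteq> 0" using n unfolding s_def q_def by auto
  have "s dvd q"
  proof (rule multiplicity_le_imp_dvd)
    fix p :: nat assume p: "prime p"
    show "multiplicity p s \<le> multiplicity p q"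
    proof (cases "p dvd s")
      case True
      then have "p ^ 2 dvd n" using assms p nsq squareful_def by auto
      then have "p dvd q" unfolding q_def by (simp add: dvd_square_part_iff)
      then have "multiplicity p q \<ge> 1" using p q0
        by (simp add: prime_multiplicity_gt_zero_iff Suc_le_eq)
      moreover have "multiplicity p s \<le> Suc 0" unfolding s_def
        using p by (rule prime_multiplicity_squarefree_part_le_Suc_0)
      ultimately show ?thesis by simp
    qed (simp add: not_dvd_imp_multiplicity_0)
  qed (use s0 q0 in auto)
  then obtain a where "q = s * a" by (rule dvdE)
  then have "n = a ^ 2 * s ^ 3" "a > 0" using nsq q0 by (auto simp: power2_eq_square power3_eq_cube)
  then show ?thesis using that s0 by blast
qed

lemma sum_min_inverse_square_le:
  fixes t :: real
  assumes "t > 0"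
  shows "(\<Sum>a=1..B. min 1 (t ^ 2 / real a ^ 2)) \<le> 4 * t"
proof -
  text \<open>The potential \<open>4 a t / (a + t)\<close> grows by at least the summand in each step.\<close>
  have "(\<Sum>a=1..B. min 1 (t ^ 2 / real a ^ 2)) \<le> 4 * real B * t / (real B + t)"
  proof (induction B)
    case (Suc B)
    define b where "b = real B"
    have b: "b \<ge> 0" unfolding b_def by simp
    have eq: "4 * (b + 1) * t / (b + 1 + t) - 4 * b * t / (b + t) =
          4 * t ^ 2 / ((b + 1 + t) * (b + t))"
      using b assms by (simp add: divide_simps) (simp add: algebra_simps power2_eq_square)
    have pos: "(b + 1 + t) * (b + t) > 0" using b assms by simp
    have "min 1 (t ^ 2 / (b + 1) ^ 2) \<le> 4 * t ^ 2 / ((b + 1 + t) * (b + t))"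
    proof (cases "b + 1 \<le> t")
      case True
      have "(b + 1 + t) * (b + t) \<le> (2 * t) * (2 * t)"
        using True b assms by (intro mult_mono) auto
      then have "1 \<le> 4 * t ^ 2 / ((b + 1 + t) * (b + t))"
        using pos by (simp add: divide_simps power2_eq_square)
      then show ?thesis by linarith
    next
      case False
      have "(b + 1 + t) * (b + t) \<le> (2 * (b + 1)) * (2 * (b + 1))"
        using False b assms by (intro mult_mono) auto
      then have "4 * t ^ 2 / ((2 * (b + 1)) * (2 * (b + 1))) \<le> 4 * t ^ 2 / ((b + 1 + t) * (b + t))"
        using pos by (intro divide_left_mono) auto
      moreover have "4 * t ^ 2 / ((2 * (b + 1)) * (2 * (b + 1))) = t ^ 2 / (b + 1) ^ 2"
        using b by (simp add: divide_simps) (simp add: power2_eq_square algebra_simps)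
      ultimately show ?thesis by linarith
    qed
    then show ?case using Suc eq unfolding b_def by (simp add: add.commute)
  qed simp
  also have "\<dots> \<le> 4 * t" using assms by (simp add: divide_simps algebra_simps)
  finally show ?thesis .
qed

text \<open>Writing \<open>d = a ^ 2 * b ^ 3\<close>, the sum over \<open>a\<close> is at most
  \<open>4 * sqrt (x / b ^ 3)\<close>, and the sum of \<open>b powr (- 3/2)\<close> converges. The
  minimum handles together the \<open>d\<close> up to \<open>x\<close>, which cost 1 each, and the
  tail, which costs \<open>x / d\<close>.\<close>

lemma squareful_sum_min_bound:
  "\<exists>C\<ge>0. \<forall>D x. finite D \<longrightarrow> (\<forall>d\<in>D. squareful d) \<longrightarrow> x > 0 \<longrightarrow>
     (\<Sum>d\<in>D. min 1 (x / real d)) \<le> C * sqrt x"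
proof -
  define u where "u = (\<lambda>b. real b powr (- (3/2)))"
  have u: "summable u" unfolding u_def by (subst summable_real_powr_iff) simp
  have u0: "u b \<ge> 0" for b unfolding u_def by simp
  show ?thesis
  proof (intro exI[of _ "4 * suminf u"] conjI allI impI)
    show "0 \<le> 4 * suminf u" using suminf_nonneg[OF u] u0 by simp
    fix D :: "nat set" and x :: real
    assume D: "finite D" "\<forall>d\<in>D. squareful d" and x: "x > 0"
    \<comment> \<open>A crude common bound for the members of \<open>D\<close>; the final estimate
      does not depend on its size.\<close>
    define B where "B = (\<Sum>d\<in>D. d)"
    have dB: "d \<le> B" if "d \<in> D" for d unfolding B_def using D that by (intro member_le_sum) auto
    let ?f = "\<lambda>(a, b). a ^ 2 * b ^ 3 :: nat"
    let ?S = "{1..B} \<times> {1..B}"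
    have sub: "D \<subseteq> ?f ` ?S"
    proof
      fix d assume d: "d \<in> D"
      then obtain a b where ab: "a > 0" "b > 0" "d = a ^ 2 * b ^ 3"
        using D squareful_decompose by metis
      have "a dvd d" "b dvd d" using ab by (simp_all add: power2_eq_square power3_eq_cube)
      then have "a \<le> d" "b \<le> d" using ab by (auto intro!: dvd_imp_le)
      with dB[OF d] ab show "d \<in> ?f ` ?S" by (intro image_eqI[where x = "(a, b)"]) auto
    qed
    have "(\<Sum>d\<in>D. min 1 (x / real d)) \<le> (\<Sum>d\<in>?f ` ?S. min 1 (x / real d))"
      using sub x by (intro sum_mono2) auto
    \<comment> \<open>Only an inequality, because \<open>d\<close> can have several representations
      \<open>a ^ 2 * b ^ 3\<close>.\<close>
    also have "\<dots> \<le> (\<Sum>z\<in>?S. min 1 (x / real (?f z)))"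
      using sum_image_le[of ?S "\<lambda>d. min 1 (x / real d)" ?f] x by (simp add: o_def)
    also have "\<dots> = (\<Sum>a\<in>{1..B}. \<Sum>b\<in>{1..B}. min 1 (x / real (a ^ 2 * b ^ 3)))"
      by (simp add: sum.cartesian_product case_prod_unfold)
    also have "\<dots> = (\<Sum>b\<in>{1..B}. \<Sum>a\<in>{1..B}. min 1 (x / real (a ^ 2 * b ^ 3)))"
      by (rule sum.swap)
    also have "\<dots> \<le> (\<Sum>b\<in>{1..B}. 4 * sqrt x * u b)"
    proof (rule sum_mono)
      fix b assume b: "b \<in> {1..B}"
      have "u b ^ 2 = real b powr (-3)" unfolding u_def using b
        by (simp add: power2_eq_square flip: powr_add)
      also have "\<dots> = 1 / real b ^ 3" using b by (simp add: powr_minus divide_inverse)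
      finally have "x / real (a ^ 2 * b ^ 3) = (sqrt x * u b) ^ 2 / real a ^ 2" for a
        using x by (simp add: power_mult_distrib)
      moreover have "sqrt x * u b > 0" using x b unfolding u_def by simp
      ultimately show "(\<Sum>a\<in>{1..B}. min 1 (x / real (a ^ 2 * b ^ 3))) \<le> 4 * sqrt x * u b"
        using sum_min_inverse_square_le[of "sqrt x * u b" B] by (simp add: mult.assoc)
    qed
    also have "\<dots> = 4 * sqrt x * (\<Sum>b\<in>{1..B}. u b)" by (simp add: sum_distrib_left)
    also have "\<dots> \<le> 4 * sqrt x * suminf u"
      using x u u0 by (intro mult_left_mono sum_le_suminf) auto
    finally show "(\<Sum>d\<in>D. min 1 (x / real d)) \<le> 4 * suminf u * sqrt x" by (simp add: mult_ac)
  qed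
qed

text \<open>Zero is never counted, so sets such as the numbers with \<open>H n <= k\<close> may
  contain it harmlessly.\<close>

definition cnt :: "nat set \<Rightarrow> real \<Rightarrow> real" where
  "cnt A x = real (card {n \<in> A. 1 \<le> n \<and> real n \<le> x})"

lemma finite_nat_le_real: "finite {n \<in> A. 1 \<le> n \<and> real n \<le> x}"
proof (rule finite_subset)
  show "{n \<in> A. 1 \<le> n \<and> real n \<le> x} \<subseteq> {..nat \<lfloor>x\<rfloor>}" by (auto simp: le_nat_floor)
qed simp

lemma card_multiples:
  assumes "d > 0"
  shows "card {n \<in> {1..N}. d dvd n} = N div d"
proof -
  have "{n \<in> {1..N}. d dvd n} = (\<lambda>k. d * k) ` {1..N div d}"
  proof (intro equalityI subsetI)
    fix n assume n: "n \<in> {n \<in> {1..N}. d dvd n}"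
    then obtain k where k: "n = d * k" by auto
    with n assms have "k \<ge> 1" "k \<le> N div d"
      by (auto intro: Nat.gr0I simp: less_eq_div_iff_mult_less_eq mult.commute)
    with k show "n \<in> (\<lambda>k. d * k) ` {1..N div d}" by auto
  next
    fix n assume "n \<in> (\<lambda>k. d * k) ` {1..N div d}"
    then show "n \<in> {n \<in> {1..N}. d dvd n}"
      using assms by (auto simp: less_eq_div_iff_mult_less_eq mult.commute)
  qed
  moreover have "inj_on (\<lambda>k. d * k) {1..N div d}" using assms by (auto intro: inj_onI)
  ultimately show ?thesis by (simp add: card_image)
qed

text \<open>The mean value of the indicator of \<open>exps_in h\<close>, as the Dirichlet series of
  its Moebius transform at 1. The term \<open>d = 0\<close> vanishes because division by zero yields
  0.\<close>

definition exps_density :: "(nat \<Rightarrow> bool) \<Rightarrow> real" where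
  "exps_density h = (\<Sum>d. exps_moebius h d / real d)"

text \<open>The count is the sum of \<open>exps_moebius h d\<close> times the integer part of
  \<open>x / d\<close>. Replacing the integer part by \<open>x / d\<close> costs at most
  \<open>min 1 (x / d)\<close> for each \<open>d\<close>, and only squareful \<open>d\<close>
  contribute. The constant comes from the squareful numbers alone and is therefore the same for all
  \<open>h\<close>.\<close>

lemma cnt_exps_in_bound:
  "\<exists>C\<ge>0. \<forall>h x. h 0 \<longrightarrow> h 1 \<longrightarrow> x > 0 \<longrightarrow>
     \<bar>cnt {n. exps_in h n} x - x * exps_density h\<bar> \<le> C * sqrt x"
proof -
  obtain C where C: "C \<ge> 0" "\<And>D x. finite D \<Longrightarrow> (\<forall>d\<in>D. squareful d) \<Longrightarrow> x > 0 \<Longrightarrow>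
     (\<Sum>d\<in>D. min 1 (x / real d)) \<le> C * sqrt x"
    using squareful_sum_min_bound by metis
  show ?thesis
  proof (intro exI[of _ C] conjI allI impI C(1))
    fix h :: "nat \<Rightarrow> bool" and x :: real
    assume h: "h 0" "h 1" and x: "x > 0"
    let ?G = "exps_moebius h"
    have supp: "(\<Sum>d<M. \<bar>?G d\<bar> * min 1 (y / real d)) \<le> C * sqrt y" if "y > 0" for M y
    proof -
      have "(\<Sum>d<M. \<bar>?G d\<bar> * min 1 (y / real d)) =
            (\<Sum>d\<in>{d. d < M \<and> squareful d}. \<bar>?G d\<bar> * min 1 (y / real d))"
      proof (rule sum.mono_neutral_right)
        show "\<forall>d\<in>{..<M} - {d. d < M \<and> squareful d}. \<bar>?G d\<bar> * min 1 (y / real d) = 0"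
        proof
          fix d assume "d \<in> {..<M} - {d. d < M \<and> squareful d}"
          then have "d = 0 \<or> ?G d = 0"
            using squareful_if_exps_moebius_nonzero[of h d] h by auto
          then show "\<bar>?G d\<bar> * min 1 (y / real d) = 0" by auto
        qed
      qed auto
      also have "\<dots> \<le> (\<Sum>d\<in>{d. d < M \<and> squareful d}. 1 * min 1 (y / real d))"
        using abs_exps_moebius_le that by (intro sum_mono mult_right_mono) auto
      also have "\<dots> \<le> C * sqrt y"
        unfolding mult_1 by (rule C(2)) (use that in auto)
      finally show ?thesis .
    qed
    \<comment> \<open>Absolute convergence is the case \<open>y = 1\<close> of \<open>supp\<close>:
      for \<open>d >= 1\<close> the minimum is then \<open>1 / d\<close>.\<close>
    have summ: "summable (\<lambda>d. ?G d / real d)"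
    proof (rule summable_norm_cancel, rule bounded_imp_summable[where B = C])
      fix M
      have "(\<Sum>d\<le>M. norm (?G d / real d)) = (\<Sum>d<Suc M. \<bar>?G d\<bar> * min 1 (1 / real d))"
        unfolding lessThan_Suc_atMost by (intro sum.cong) (auto simp: min_def divide_simps)
      also have "\<dots> \<le> C * sqrt 1" by (rule supp) simp
      finally show "(\<Sum>d\<le>M. norm (?G d / real d)) \<le> C" unfolding real_sqrt_one mult_1_right .
    qed simp
    define N where "N = nat \<lfloor>x\<rfloor>"
    have N: "real N \<le> x" "x < real N + 1" using x unfolding N_def by linarith+
    have le_iff: "real n \<le> x \<longleftrightarrow> n \<le> N" for n using N by linarith
    have cnt_eq: "cnt {n. exps_in h n} x = (\<Sum>d\<in>{1..N}. ?G d * real (N div d))"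
    proof -
      have "{n \<in> {n. exps_in h n}. 1 \<le> n \<and> real n \<le> x} = {n \<in> {1..N}. exps_in h n}"
        using le_iff by auto
      then have "cnt {n. exps_in h n} x = (\<Sum>n\<in>{1..N}. of_bool (exps_in h n))"
        unfolding cnt_def by (simp add: sum_of_bool_eq Int_def conj_ac)
      also have "\<dots> = (\<Sum>n\<in>{1..N}. \<Sum>d | d dvd n. ?G d)"
        using sum_divisors_exps_moebius h by (intro sum.cong) auto
      also have "\<dots> = (\<Sum>n\<in>{1..N}. \<Sum>d\<in>{1..N}. if d dvd n then ?G d else 0)"
      proof (rule sum.cong)
        fix n assume n: "n \<in> {1..N}"
        have "{d. d dvd n} = {d \<in> {1..N}. d dvd n}"
          using n by (auto dest: dvd_imp_le intro: Nat.gr0I)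
        then have "(\<Sum>d | d dvd n. ?G d) = (\<Sum>d\<in>{d \<in> {1..N}. d dvd n}. ?G d)" by simp
        also have "\<dots> = (\<Sum>d\<in>{1..N}. if d dvd n then ?G d else 0)"
          by (rule sum.inter_filter) simp
        finally show "(\<Sum>d | d dvd n. ?G d) = (\<Sum>d\<in>{1..N}. if d dvd n then ?G d else 0)" .
      qed simp
      also have "\<dots> = (\<Sum>d\<in>{1..N}. \<Sum>n\<in>{1..N}. if d dvd n then ?G d else 0)" by (rule sum.swap)
      also have "\<dots> = (\<Sum>d\<in>{1..N}. ?G d * real (N div d))"
      proof (rule sum.cong)
        fix d assume d: "d \<in> {1..N}"
        have "(\<Sum>n\<in>{1..N}. if d dvd n then ?G d else 0) = (\<Sum>n\<in>{n\<in>{1..N}. d dvd n}. ?G d)"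
          by (rule sum.inter_filter[symmetric]) simp
        also have "\<dots> = ?G d * real (N div d)" using card_multiples[of d N] d by simp
        finally show "(\<Sum>n\<in>{1..N}. if d dvd n then ?G d else 0) = ?G d * real (N div d)" .
      qed simp
      finally show ?thesis .
    qed
    \<comment> \<open>Terms with \<open>d > N\<close> have \<open>N div d = 0\<close>, so the
      divisor sum may be extended to any \<open>M > N\<close>. The bound is uniform in
      \<open>M\<close> and survives the passage to the limit.\<close>
    have bound: "\<bar>cnt {n. exps_in h n} x - x * (\<Sum>d<M. ?G d / real d)\<bar> \<le> C * sqrt x" if M: "M > N" for M
    proof -
      have "cnt {n. exps_in h n} x = (\<Sum>d<M. ?G d * real (N div d))"
        unfolding cnt_eq using M
        by (intro sum.mono_neutral_left) (auto simp: not_le intro: Nat.gr0I)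
      then have "\<bar>cnt {n. exps_in h n} x - x * (\<Sum>d<M. ?G d / real d)\<bar> =
            \<bar>\<Sum>d<M. ?G d * (real (N div d) - x / real d)\<bar>"
        by (simp add: sum_distrib_left sum_subtractf algebra_simps)
      also have "\<dots> \<le> (\<Sum>d<M. \<bar>?G d\<bar> * \<bar>real (N div d) - x / real d\<bar>)"
        using sum_abs[of "\<lambda>d. ?G d * (real (N div d) - x / real d)"] by (simp add: abs_mult)
      also have "\<dots> \<le> (\<Sum>d<M. \<bar>?G d\<bar> * min 1 (x / real d))"
      proof (intro sum_mono mult_left_mono)
        fix d
        show "\<bar>real (N div d) - x / real d\<bar> \<le> min 1 (x / real d)"
        proof (cases "d = 0")
          case False
          have "N div d * d \<le> N" by simp
          then have "real (N div d) * real d \<le> x" using N by (metis of_nat_mult of_nat_le_iff order_trans)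
          then have 1: "real (N div d) \<le> x / real d" using False by (simp add: pos_le_divide_eq)
          have "N < (N div d + 1) * d" using False
            by (metis Suc_eq_plus1 dividend_less_times_div mult.commute mult_Suc_right neq0_conv add.commute)
          then have "N + 1 \<le> (N div d + 1) * d" by simp
          then have "real (N + 1) \<le> real ((N div d + 1) * d)" by (simp only: of_nat_le_iff)
          then have "x < (real (N div d) + 1) * real d" using N by (simp add: algebra_simps)
          then have 2: "x / real d < real (N div d) + 1" using False by (simp add: pos_divide_less_eq)
          show ?thesis using 1 2 by (simp add: min_def)
        qed simp
      qed simp
      also have "\<dots> \<le> C * sqrt x" by (rule supp[OF x])
      finally show ?thesis .
    qed
    have "(\<lambda>M. \<Sum>d<M. ?G d / real d) \<longlonglongrightarrow> exps_density h"
      unfolding exps_density_def using summable_LIMSEQ[OF summ] .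
    then have "(\<lambda>M. \<bar>cnt {n. exps_in h n} x - x * (\<Sum>d<M. ?G d / real d)\<bar>) \<longlonglongrightarrow>
               \<bar>cnt {n. exps_in h n} x - x * exps_density h\<bar>"
      by (intro tendsto_intros)
    then show "\<bar>cnt {n. exps_in h n} x - x * exps_density h\<bar> \<le> C * sqrt x"
      by (rule LIMSEQ_le_const2) (use bound in \<open>auto intro!: exI[of _ "Suc N"]\<close>)
  qed
qed

section \<open>Natural density\<close>

definition has_dens :: "nat set \<Rightarrow> real \<Rightarrow> bool" where
  "has_dens A \<delta> \<longleftrightarrow> ((\<lambda>x. cnt A x / x) \<longlongrightarrow> \<delta>) at_top"

lemma cnt_nonneg [simp]: "cnt A x \<ge> 0"
  by (simp add: cnt_def)

lemma cnt_mono: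
  assumes "\<And>n. n \<ge> 1 \<Longrightarrow> n \<in> A \<Longrightarrow> n \<in> B"
  shows "cnt A x \<le> cnt B x"
  unfolding cnt_def of_nat_le_iff
  by (rule card_mono[OF finite_nat_le_real]) (use assms in auto)

lemma cnt_cong:
  assumes "\<And>n. n \<ge> 1 \<Longrightarrow> n \<in> A \<longleftrightarrow> n \<in> B"
  shows "cnt A x = cnt B x"
  using assms by (intro antisym cnt_mono) auto

lemma cnt_Un_le: "cnt (A \<union> B) x \<le> cnt A x + cnt B x"
proof -
  have "{n \<in> A \<union> B. 1 \<le> n \<and> real n \<le> x} =
        {n \<in> A. 1 \<le> n \<and> real n \<le> x} \<union> {n \<in> B. 1 \<le> n \<and> real n \<le> x}" by auto
  then show ?thesis unfolding cnt_def of_nat_add[symmetric] of_nat_le_iff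
    by (simp only: card_Un_le)
qed

lemma cnt_Diff:
  assumes "B \<subseteq> A"
  shows "cnt (A - B) x = cnt A x - cnt B x"
proof -
  have "{n \<in> A - B. 1 \<le> n \<and> real n \<le> x} =
        {n \<in> A. 1 \<le> n \<and> real n \<le> x} - {n \<in> B. 1 \<le> n \<and> real n \<le> x}" by auto
  moreover have "{n \<in> B. 1 \<le> n \<and> real n \<le> x} \<subseteq> {n \<in> A. 1 \<le> n \<and> real n \<le> x}"
    using assms by auto
  ultimately show ?thesis unfolding cnt_def
    by (simp only: card_Diff_subset finite_nat_le_real card_mono of_nat_diff)
qed

lemma cnt_UNIV_eq: "x \<ge> 0 \<Longrightarrow> cnt UNIV x = of_int \<lfloor>x\<rfloor>"
proof -
  assume x: "x \<ge> 0"
  have "{n \<in> UNIV. 1 \<le> n \<and> real n \<le> x} = {1..nat \<lfloor>x\<rfloor>}"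
    using x by (auto simp: le_nat_floor) linarith
  then show ?thesis unfolding cnt_def using x by simp
qed

lemma cnt_le: "x \<ge> 0 \<Longrightarrow> cnt A x \<le> x"
proof -
  assume x: "x \<ge> 0"
  have "cnt A x \<le> cnt UNIV x" by (rule cnt_mono) simp
  also have "\<dots> \<le> x" using cnt_UNIV_eq[OF x] by simp
  finally show ?thesis .
qed

lemma has_dens_of_bound:
  assumes "\<And>x. x \<ge> 1 \<Longrightarrow> \<bar>cnt A x - x * \<delta>\<bar> \<le> C * sqrt x"
  shows "has_dens A \<delta>"
  unfolding has_dens_def
proof (rule LIM_zero_cancel, rule Lim_transform_bound)
  have "filterlim sqrt at_top at_top" by (rule sqrt_at_top)
  then show "((\<lambda>x. C / sqrt x) \<longlongrightarrow> 0) at_top"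
    by (intro tendsto_divide_0[OF tendsto_const] filterlim_at_top_imp_at_infinity)
  show "\<forall>\<^sub>F x in at_top. norm (cnt A x / x - \<delta>) \<le> norm (C / sqrt x)"
    using eventually_ge_at_top[of 1]
  proof eventually_elim
    case (elim x)
    have "norm (cnt A x / x - \<delta>) = \<bar>cnt A x - x * \<delta>\<bar> / x"
      using elim by (simp add: field_simps abs_if)
    also have "\<dots> \<le> C * sqrt x / x" using assms[OF elim] elim by (intro divide_right_mono) auto
    also have "\<dots> = C / sqrt x" using elim by (simp add: field_simps)
    also have "\<dots> \<le> norm (C / sqrt x)" unfolding real_norm_def by (rule abs_ge_self)
    finally show ?case .
  qed
qed

lemma has_dens_UNIV: "has_dens UNIV 1"
proof (rule has_dens_of_bound[where C = 1])
  fix x :: real assume x: "x \<ge> 1"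
  then have "1 \<le> sqrt x" by simp
  moreover have "\<bar>cnt UNIV x - x * 1\<bar> \<le> 1" using cnt_UNIV_eq[of x] x by linarith
  ultimately show "\<bar>cnt UNIV x - x * 1\<bar> \<le> 1 * sqrt x" by linarith
qed

lemma has_dens_Diff:
  assumes "has_dens A a" "has_dens B b" "B \<subseteq> A"
  shows "has_dens (A - B) (a - b)"
  using tendsto_diff[OF assms(1,2)[unfolded has_dens_def]]
  unfolding has_dens_def cnt_Diff[OF assms(3)] by (simp add: diff_divide_distrib)

lemma has_dens_cong:
  assumes "\<And>n. n \<ge> 1 \<Longrightarrow> n \<in> A \<longleftrightarrow> n \<in> B" "has_dens A \<delta>"
  shows "has_dens B \<delta>"
proof -
  have "cnt A x = cnt B x" for x by (rule cnt_cong) (use assms in auto)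
  then show ?thesis using assms(2) by (simp add: has_dens_def)
qed

lemma has_dens_le:
  assumes "has_dens A a" "has_dens B b" "\<And>x. x \<ge> 1 \<Longrightarrow> cnt A x \<le> cnt B x + c * x"
  shows "a \<le> b + c"
proof -
  have "((\<lambda>x. cnt B x / x + c) \<longlongrightarrow> b + c) at_top"
    using assms(2) unfolding has_dens_def by (intro tendsto_intros)
  then show ?thesis using assms(1) unfolding has_dens_def
  proof (rule tendsto_le[OF trivial_limit_at_top_linorder])
    show "\<forall>\<^sub>F x in at_top. cnt A x / x \<le> cnt B x / x + c"
      using eventually_ge_at_top[of 1]
      by eventually_elim (use assms(3) in \<open>simp add: field_simps\<close>)
  qed
qed

lemma has_dens_le_const:
  assumes "has_dens A a" "\<And>x. x \<ge> 1 \<Longrightarrow> cnt A x \<le> c * x"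
  shows "a \<le> c"
proof -
  have "has_dens {} 0" unfolding has_dens_def cnt_def by simp
  then show ?thesis using has_dens_le[OF assms(1), of "{}" 0 c] assms(2) by (simp add: cnt_def)
qed

lemma has_dens_mono:
  assumes "has_dens A a" "has_dens B b" "\<And>n. n \<ge> 1 \<Longrightarrow> n \<in> A \<Longrightarrow> n \<in> B"
  shows "a \<le> b"
proof -
  have "cnt A x \<le> cnt B x" for x by (rule cnt_mono) (use assms in auto)
  then show ?thesis using has_dens_le[OF assms(1,2), of 0] by simp
qed

text \<open>A union bound: at most \<open>x / m ^ t\<close> multiples of \<open>m ^ t\<close> lie
  below \<open>x\<close>, and only \<open>m <= x\<close> can occur, so a bound \<open>s\<close> for
  the finite partial sums suffices.\<close>

lemma cnt_power_multiples_le: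
  assumes t: "t > 0" and M: "M \<ge> 1" and s: "\<And>K. (\<Sum>m=M..K. 1 / real m ^ t) \<le> s" and x: "x \<ge> 0"
  shows "cnt {n. \<exists>m\<ge>M. m ^ t dvd n} x \<le> s * x"
proof -
  define N where "N = nat \<lfloor>x\<rfloor>"
  have N: "real N \<le> x" "x < real N + 1" using x unfolding N_def by linarith+
  have "{n \<in> {n. \<exists>m\<ge>M. m ^ t dvd n}. 1 \<le> n \<and> real n \<le> x} \<subseteq>
        (\<Union>m\<in>{M..N}. {n \<in> {1..N}. m ^ t dvd n})"
  proof
    fix n assume n: "n \<in> {n \<in> {n. \<exists>m\<ge>M. m ^ t dvd n}. 1 \<le> n \<and> real n \<le> x}"
    then obtain m where m: "m \<ge> M" "m ^ t dvd n" by auto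
    have "n \<le> N" using n N by auto
    have "m \<le> m ^ t" using t M m by (intro self_le_power) auto
    also have "\<dots> \<le> n" using m n by (auto intro: dvd_imp_le)
    finally show "n \<in> (\<Union>m\<in>{M..N}. {n \<in> {1..N}. m ^ t dvd n})"
      using m n \<open>n \<le> N\<close> by auto
  qed
  then have "card {n \<in> {n. \<exists>m\<ge>M. m ^ t dvd n}. 1 \<le> n \<and> real n \<le> x} \<le>
        card (\<Union>m\<in>{M..N}. {n \<in> {1..N}. m ^ t dvd n})"
    by (intro card_mono) auto
  also have "\<dots> \<le> (\<Sum>m\<in>{M..N}. card {n \<in> {1..N}. m ^ t dvd n})"
    by (rule card_UN_le) simp
  also have "\<dots> = (\<Sum>m\<in>{M..N}. N div m ^ t)"
    using M by (intro sum.cong card_multiples) auto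
  finally have "cnt {n. \<exists>m\<ge>M. m ^ t dvd n} x \<le> (\<Sum>m\<in>{M..N}. real (N div m ^ t))"
    unfolding cnt_def of_nat_sum[symmetric] of_nat_le_iff .
  also have "\<dots> \<le> (\<Sum>m\<in>{M..N}. x * (1 / real m ^ t))"
  proof (rule sum_mono)
    fix m assume "m \<in> {M..N}"
    have "real (N div m ^ t) \<le> real N / real (m ^ t)" by (rule of_nat_div_le_of_nat)
    also have "\<dots> \<le> x / real (m ^ t)" using N by (intro divide_right_mono) auto
    finally show "real (N div m ^ t) \<le> x * (1 / real m ^ t)" by simp
  qed
  also have "\<dots> = x * (\<Sum>m\<in>{M..N}. 1 / real m ^ t)" by (simp add: sum_distrib_left)
  also have "\<dots> \<le> x * s" using x s by (intro mult_left_mono) auto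
  finally show ?thesis by (simp add: mult.commute)
qed

text \<open>All but two of the factors \<open>1 / m\<close> are estimated by \<open>1 / M\<close>;
  the remaining squares telescope to \<open>1 / (M - 1)\<close>. The leading factor is 4 for
  \<open>M = 2\<close> and 25/4 for \<open>M = 5\<close>.\<close>

lemma sum_inverse_powers_le:
  assumes M: "M \<ge> 2" and t: "t \<ge> 2"
  shows "(\<Sum>m=M..K. 1 / real m ^ t) \<le> real M ^ 2 / real (M - 1) * (1 / real M ^ t)"
proof -
  obtain i where i: "t = i + 2" using t by (metis le_add_diff_inverse2)
  have tele: "(\<Sum>m=M..K. 1 / real m ^ 2) \<le> 1 / real (M - 1)"
  proof (cases "K \<ge> M")
    case True
    have "(\<Sum>m=M..K. 1 / real m ^ 2) \<le> 1 / real (M - 1) - 1 / real K"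
      using True
    proof (induction K rule: dec_induct)
      case base
      have "1 / real M ^ 2 \<le> 1 / (real M * (real M - 1))"
        using M by (intro divide_left_mono) (auto simp: power2_eq_square)
      also have "\<dots> = 1 / (real M - 1) - 1 / real M" using M by (simp add: field_simps)
      finally show ?case using M by (simp add: of_nat_diff)
    next
      case (step K)
      have K: "real K > 0" using step M by simp
      have "1 / real (Suc K) ^ 2 \<le> 1 / (real (Suc K) * real K)"
        using K by (intro divide_left_mono) (auto simp: power2_eq_square)
      also have "\<dots> = 1 / real K - 1 / real (Suc K)" using K by (simp add: field_simps)
      finally show ?case using step by simp
    qed
    then show ?thesis by (smt (verit) divide_nonneg_nonneg of_nat_0_le_iff)
  qed simp
  have "(\<Sum>m=M..K. 1 / real m ^ t) \<le> (\<Sum>m=M..K. 1 / real M ^ i * (1 / real m ^ 2))"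
  proof (rule sum_mono)
    fix m assume m: "m \<in> {M..K}"
    have "real M ^ i \<le> real m ^ i" using m by (intro power_mono) auto
    then have "real M ^ i * real m ^ 2 \<le> real m ^ t"
      unfolding i power_add by (intro mult_right_mono) auto
    then show "1 / real m ^ t \<le> 1 / real M ^ i * (1 / real m ^ 2)"
      using m M by (simp add: divide_simps)
  qed
  also have "\<dots> = 1 / real M ^ i * (\<Sum>m=M..K. 1 / real m ^ 2)" by (simp add: sum_distrib_left)
  also have "\<dots> \<le> 1 / real M ^ i * (1 / real (M - 1))" using tele by (intro mult_left_mono) auto
  also have "\<dots> = real M ^ 2 / real (M - 1) * (1 / real M ^ t)"
    using M by (simp add: i power_add power2_eq_square)
  finally show ?thesis .
qed

section \<open>Independence of the exponents of different primes\<close>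

text \<open>For positive \<open>n\<close>, membership in \<open>A\<close> is insensitive to the
  exponent of \<open>p\<close>.\<close>

definition scale_inv :: "nat \<Rightarrow> nat set \<Rightarrow> bool" where
  "scale_inv p A \<longleftrightarrow> (\<forall>n\<ge>1. n \<in> A \<longleftrightarrow> p * n \<in> A)"

lemma scale_inv_power:
  assumes "scale_inv p A" "p > 0" "n \<ge> 1"
  shows "n \<in> A \<longleftrightarrow> p ^ i * n \<in> A"
proof (induction i)
  case (Suc i)
  have "p ^ i * n \<ge> 1" using assms by simp
  then show ?case using assms(1) Suc unfolding scale_inv_def by (metis mult.assoc power_Suc)
qed simp

text \<open>Multiplication by \<open>p ^ i\<close> maps the members of \<open>A\<close> up to
  \<open>x / p ^ i\<close> bijectively onto the multiples of \<open>p ^ i\<close> in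
  \<open>A\<close> up to \<open>x\<close>.\<close>

lemma has_dens_power_multiples:
  assumes A: "scale_inv p A" "has_dens A \<delta>" and p: "p > 0"
  shows "has_dens {n \<in> A. p ^ i dvd n} (\<delta> / real p ^ i)"
proof -
  have eq: "cnt {n \<in> A. p ^ i dvd n} x = cnt A (x / real p ^ i)" for x
  proof -
    have "{n \<in> {n \<in> A. p ^ i dvd n}. 1 \<le> n \<and> real n \<le> x} =
          (\<lambda>m. p ^ i * m) ` {n \<in> A. 1 \<le> n \<and> real n \<le> x / real p ^ i}"
    proof (intro equalityI subsetI)
      fix n assume n: "n \<in> {n \<in> {n \<in> A. p ^ i dvd n}. 1 \<le> n \<and> real n \<le> x}"
      then obtain m where m: "n = p ^ i * m" by auto
      have "m \<ge> 1" using n m by (cases m) auto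
      moreover have "m \<in> A" using n m scale_inv_power[OF A(1) p \<open>m \<ge> 1\<close>] by auto
      moreover have "real m \<le> x / real p ^ i" using n m p by (simp add: field_simps)
      ultimately show "n \<in> (\<lambda>m. p ^ i * m) ` {n \<in> A. 1 \<le> n \<and> real n \<le> x / real p ^ i}"
        using m by auto
    next
      fix n assume "n \<in> (\<lambda>m. p ^ i * m) ` {n \<in> A. 1 \<le> n \<and> real n \<le> x / real p ^ i}"
      then obtain m where m: "n = p ^ i * m" "m \<in> A" "1 \<le> m" "real m \<le> x / real p ^ i" by auto
      then show "n \<in> {n \<in> {n \<in> A. p ^ i dvd n}. 1 \<le> n \<and> real n \<le> x}"
        using p scale_inv_power[OF A(1) p m(3), of i] by (auto simp: field_simps Suc_le_eq)
    qed
    moreover have "inj_on (\<lambda>m. p ^ i * m) {n \<in> A. 1 \<le> n \<and> real n \<le> x / real p ^ i}"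
      using p by (auto intro: inj_onI)
    ultimately show ?thesis unfolding cnt_def by (simp add: card_image)
  qed
  have pi: "real p ^ i > 0" using p by simp
  have "filterlim (\<lambda>x. (1 / real p ^ i) * x) at_top at_top"
    using pi by (intro filterlim_tendsto_pos_mult_at_top[OF tendsto_const]) (auto simp: filterlim_ident)
  then have "filterlim (\<lambda>x. x / real p ^ i) at_top at_top" by simp
  with A(2) have "((\<lambda>x. cnt A (x / real p ^ i) / (x / real p ^ i)) \<longlongrightarrow> \<delta>) at_top"
    unfolding has_dens_def by (rule filterlim_compose)
  then have "((\<lambda>x. cnt A (x / real p ^ i) / (x / real p ^ i) / real p ^ i) \<longlongrightarrow> \<delta> / real p ^ i) at_top"
    using pi by (intro tendsto_divide tendsto_const) auto
  then show ?thesis unfolding has_dens_def eq using p by (simp add: power_0_left)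
qed

text \<open>Independence is built in: the condition on the exponent of \<open>p\<close> multiplies
  the density of every set insensitive to \<open>p\<close> by the same \<open>c\<close>. This lets
  conditions at different primes be imposed one after another.\<close>

definition local_dens :: "nat \<Rightarrow> nat set \<Rightarrow> real \<Rightarrow> bool" where
  "local_dens p F c \<longleftrightarrow>
     (\<forall>A \<delta>. scale_inv p A \<longrightarrow> has_dens A \<delta> \<longrightarrow> has_dens {n \<in> A. multiplicity p n \<in> F} (\<delta> * c))"

text \<open>Exponent exactly \<open>i\<close> means divisible by \<open>p ^ i\<close> but not by
  \<open>p ^ (i + 1)\<close>; finitely many disjoint cases add up.\<close>

lemma local_dens_finite:
  assumes p: "prime p" and F: "finite F"
  shows "local_dens p F (\<Sum>i\<in>F. 1 / real p ^ i - 1 / real p ^ (i + 1))"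
  unfolding local_dens_def
proof (intro allI impI)
  fix A \<delta> assume A: "scale_inv p A" "has_dens A \<delta>"
  have p0: "p > 0" using p by (simp add: prime_gt_0_nat)
  show "has_dens {n \<in> A. multiplicity p n \<in> F} (\<delta> * (\<Sum>i\<in>F. 1 / real p ^ i - 1 / real p ^ (i + 1)))"
    using F
  proof induction
    case empty
    then show ?case unfolding has_dens_def cnt_def by simp
  next
    case (insert i F)
    let ?B = "{n \<in> A. p ^ i dvd n} - {n \<in> A. p ^ (i + 1) dvd n}"
    have "has_dens ?B (\<delta> / real p ^ i - \<delta> / real p ^ (i + 1))"
      by (intro has_dens_Diff has_dens_power_multiples A p0) (auto dest: power_le_dvd)
    then have B: "has_dens {n \<in> A. multiplicity p n = i} (\<delta> / real p ^ i - \<delta> / real p ^ (i + 1))"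
    proof (rule has_dens_cong[rotated])
      fix n :: nat assume n: "n \<ge> 1"
      have *: "p ^ j dvd n \<longleftrightarrow> j \<le> multiplicity p n" for j
        using n p by (intro power_dvd_iff_le_multiplicity) auto
      show "n \<in> ?B \<longleftrightarrow> n \<in> {n \<in> A. multiplicity p n = i}"
        using *[of i] *[of "i + 1"] by auto
    qed
    have disj: "{n \<in> A. multiplicity p n = i} \<inter> {n \<in> A. multiplicity p n \<in> F} = {}"
      using insert by auto
    have "cnt {n \<in> A. multiplicity p n \<in> insert i F} x =
          cnt {n \<in> A. multiplicity p n = i} x + cnt {n \<in> A. multiplicity p n \<in> F} x" for x
    proof -
      have "{n \<in> A. multiplicity p n \<in> insert i F} - {n \<in> A. multiplicity p n = i} =
            {n \<in> A. multiplicity p n \<in> F}" using disj by auto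
      then show ?thesis
        using cnt_Diff[of "{n \<in> A. multiplicity p n = i}" "{n \<in> A. multiplicity p n \<in> insert i F}" x]
        by (simp add: Collect_mono)
    qed
    then show ?case using tendsto_add[OF B[unfolded has_dens_def] insert.IH[unfolded has_dens_def]] insert.hyps
      unfolding has_dens_def by (simp add: add_divide_distrib algebra_simps)
  qed
qed

lemma local_dens_Compl:
  assumes "local_dens p F c"
  shows "local_dens p (- F) (1 - c)"
  unfolding local_dens_def
proof (intro allI impI)
  fix A \<delta> assume A: "scale_inv p A" "has_dens A \<delta>"
  have "has_dens {n \<in> A. multiplicity p n \<in> F} (\<delta> * c)"
    using assms A unfolding local_dens_def by blast
  then have "has_dens (A - {n \<in> A. multiplicity p n \<in> F}) (\<delta> - \<delta> * c)"
    using A(2) by (intro has_dens_Diff) auto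
  moreover have "A - {n \<in> A. multiplicity p n \<in> F} = {n \<in> A. multiplicity p n \<in> - F}" by auto
  ultimately show "has_dens {n \<in> A. multiplicity p n \<in> - F} (\<delta> * (1 - c))"
    by (simp add: algebra_simps)
qed

text \<open>A set described by exponents at the primes in \<open>S\<close> is insensitive to a new
  prime \<open>q\<close>, so the condition at \<open>q\<close> contributes the factor
  \<open>c q\<close>.\<close>

lemma has_dens_exponents:
  assumes "finite S" "\<And>p. p \<in> S \<Longrightarrow> prime p" "\<And>p. p \<in> S \<Longrightarrow> local_dens p (F p) (c p)"
  shows "has_dens {n. \<forall>p\<in>S. multiplicity p n \<in> F p} (\<Prod>p\<in>S. c p)"
  using assms
proof (induction S)
  case empty
  then show ?case using has_dens_UNIV by simp
next
  case (insert q S)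
  let ?A = "{n. \<forall>p\<in>S. multiplicity p n \<in> F p}"
  have "scale_inv q ?A"
    unfolding scale_inv_def
  proof (intro allI impI)
    fix n :: nat assume n: "n \<ge> 1"
    have "multiplicity p (q * n) = multiplicity p n" if "p \<in> S" for p
    proof -
      have "prime p" "prime q" "p \<noteq> q" using that insert by auto
      then show ?thesis using n
        by (simp add: prime_elem_multiplicity_mult_distrib prime_multiplicity_other)
    qed
    then show "n \<in> ?A \<longleftrightarrow> q * n \<in> ?A" by auto
  qed
  moreover have "has_dens ?A (prod c S)" using insert by auto
  ultimately have "has_dens {n \<in> ?A. multiplicity q n \<in> F q} (prod c S * c q)"
    using insert.prems(2)[of q] unfolding local_dens_def by blast
  moreover have "{n \<in> ?A. multiplicity q n \<in> F q} = {n. \<forall>p\<in>insert q S. multiplicity p n \<in> F p}"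
    by auto
  ultimately show ?case using insert.hyps by (simp add: mult.commute)
qed

lemma has_dens_exponent:
  assumes "prime p" "local_dens p F c"
  shows "has_dens {n. multiplicity p n \<in> F} c"
  using has_dens_exponents[of "{p}" "\<lambda>_. F" "\<lambda>_. c"] assms by simp

section \<open>The density of integers of bounded height\<close>

text \<open>Height at most \<open>Suc j\<close> means that all exponents have height at most
  \<open>j\<close>, hence the shift. Height 0 leaves only the number 1, of density 0.\<close>

definition Hdens :: "nat \<Rightarrow> real" where
  "Hdens k = (case k of 0 \<Rightarrow> 0 | Suc j \<Rightarrow> exps_density (\<lambda>a. H a \<le> j))"

lemma H_eq_0_iff: "n \<ge> 1 \<Longrightarrow> H n = 0 \<longleftrightarrow> n = 1"
  using H_pos_iff[of n] by auto

lemma cnt_H_le_bound: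
  "\<exists>C\<ge>0. \<forall>k x. x \<ge> 1 \<longrightarrow> \<bar>cnt {n. H n \<le> k} x - x * Hdens k\<bar> \<le> C * sqrt x"
proof -
  obtain C where C: "C \<ge> 0" "\<And>h x. h 0 \<Longrightarrow> h 1 \<Longrightarrow> x > 0 \<Longrightarrow>
      \<bar>cnt {n. exps_in h n} x - x * exps_density h\<bar> \<le> C * sqrt x"
    using cnt_exps_in_bound by blast
  show ?thesis
  \<comment> \<open>The 1 covers \<open>k = 0\<close>, where a single number is counted.\<close>
  proof (intro exI[of _ "max C 1"] conjI allI impI)
    fix k and x :: real assume x: "x \<ge> 1"
    show "\<bar>cnt {n. H n \<le> k} x - x * Hdens k\<bar> \<le> max C 1 * sqrt x"
    proof (cases k)
      case 0
      have "{n \<in> {n. H n \<le> 0}. 1 \<le> n \<and> real n \<le> x} \<subseteq> {1}"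
        using H_eq_0_iff by auto
      then have "card {n \<in> {n. H n \<le> 0}. 1 \<le> n \<and> real n \<le> x} \<le> card {1::nat}"
        by (intro card_mono) auto
      then have "cnt {n. H n \<le> k} x \<le> 1" unfolding cnt_def 0 by simp
      moreover have "1 * 1 \<le> max C 1 * sqrt x" using x by (intro mult_mono) auto
      ultimately show ?thesis using 0 by (simp add: Hdens_def)
    next
      case (Suc j)
      have "cnt {n. H n \<le> k} x = cnt {n. exps_in (\<lambda>a. H a \<le> j) n} x"
        unfolding Suc by (rule cnt_cong) (simp add: exps_in_def H_le_Suc_iff)
      then have "\<bar>cnt {n. H n \<le> k} x - x * Hdens k\<bar> \<le> C * sqrt x"
        using C(2)[of "\<lambda>a. H a \<le> j" x] x Suc by (simp add: Hdens_def)
      also have "\<dots> \<le> max C 1 * sqrt x" using x by (intro mult_right_mono) auto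
      finally show ?thesis .
    qed
  qed simp
qed

lemma has_dens_H_le: "has_dens {n. H n \<le> k} (Hdens k)"
proof -
  obtain C where "\<And>x. x \<ge> 1 \<Longrightarrow> \<bar>cnt {n. H n \<le> k} x - x * Hdens k\<bar> \<le> C * sqrt x"
    using cnt_H_le_bound by blast
  then show ?thesis by (rule has_dens_of_bound)
qed

lemma has_dens_H_gr: "has_dens {n. k < H n} (1 - Hdens k)"
proof -
  have "has_dens (UNIV - {n. H n \<le> k}) (1 - Hdens k)"
    by (intro has_dens_Diff has_dens_UNIV has_dens_H_le) simp
  then show ?thesis by (rule has_dens_cong[rotated]) auto
qed

lemma Hdens_le_1: "Hdens k \<le> 1"
  using has_dens_mono[OF has_dens_H_le has_dens_UNIV] by simp

lemma Dcount_Suc: "Dcount (Suc k) x = cnt {n. H n \<le> Suc k} x - cnt {n. H n \<le> k} x"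
proof -
  have "Dcount (Suc k) x = cnt ({n. H n \<le> Suc k} - {n. H n \<le> k}) x"
    unfolding Dcount_def cnt_def by (intro arg_cong[where f = real] arg_cong[where f = card]) auto
  also have "\<dots> = cnt {n. H n \<le> Suc k} x - cnt {n. H n \<le> k} x"
    by (rule cnt_Diff) auto
  finally show ?thesis .
qed

text \<open>Shows that the limit in \<open>Ddens\<close> exists, so that \<open>Lim\<close> really
  denotes it.\<close>

lemma Ddens_Suc: "Ddens (Suc k) = Hdens (Suc k) - Hdens k"
proof -
  have "((\<lambda>x. cnt {n. H n \<le> Suc k} x / x - cnt {n. H n \<le> k} x / x) \<longlongrightarrow> Hdens (Suc k) - Hdens k) at_top"
    using has_dens_H_le unfolding has_dens_def by (intro tendsto_diff) auto
  then have "((\<lambda>x. Dcount (Suc k) x / x) \<longlongrightarrow> Hdens (Suc k) - Hdens k) at_top"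
    by (simp add: Dcount_Suc diff_divide_distrib)
  then show ?thesis unfolding Ddens_def by (intro tendsto_Lim) auto
qed

lemma Dcount_bound:
  "\<exists>C\<ge>0. \<forall>k x. x \<ge> 1 \<longrightarrow> \<bar>Dcount (Suc k) x - x * Ddens (Suc k)\<bar> \<le> C * sqrt x"
proof -
  obtain C where C: "C \<ge> 0" "\<And>k x. x \<ge> 1 \<Longrightarrow> \<bar>cnt {n. H n \<le> k} x - x * Hdens k\<bar> \<le> C * sqrt x"
    using cnt_H_le_bound by blast
  show ?thesis
  proof (intro exI[of _ "2 * C"] conjI allI impI)
    fix k and x :: real assume x: "x \<ge> 1"
    show "\<bar>Dcount (Suc k) x - x * Ddens (Suc k)\<bar> \<le> 2 * C * sqrt x"
      using C(2)[OF x, of k] C(2)[OF x, of "Suc k"]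
      unfolding Dcount_Suc Ddens_Suc by (simp add: algebra_simps)
  qed (use C in simp)
qed

section \<open>The density of numbers of height greater than k\<close>

lemma tet_ge_2: "k \<ge> 1 \<Longrightarrow> tet 2 k \<ge> 2"
  using tet_mono[of 1 k] by simp

text \<open>Height above \<open>k\<close> forces some prime to an exponent of at least
  \<open>tet 2 k\<close>. The bound is proportional to \<open>x\<close> with no
  \<open>sqrt x\<close> error, which matters when it is multiplied by a weight as large as
  \<open>x\<close>.\<close>

lemma cnt_H_gr_le:
  assumes k: "k \<ge> 1" and x: "x \<ge> 0"
  shows "cnt {n. k < H n} x \<le> 4 / 2 ^ tet 2 k * x"
proof -
  have "cnt {n. k < H n} x \<le> cnt {n. \<exists>m\<ge>2. m ^ tet 2 k dvd n} x"
  proof (rule cnt_mono)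
    fix n :: nat assume n: "n \<ge> 1" "n \<in> {n. k < H n}"
    then obtain p where p: "prime p" "k \<le> H (multiplicity p n)"
      using Suc_le_H_iff[of n k] k by auto
    have "multiplicity p n > 0" using p k by (cases "multiplicity p n") auto
    then have "tet 2 k \<le> multiplicity p n" using p tet_le_of_le_H by blast
    then show "n \<in> {n. \<exists>m\<ge>2. m ^ tet 2 k dvd n}"
      using p by (auto intro!: exI[of _ p] multiplicity_dvd' prime_ge_2_nat)
  qed
  also have "\<dots> \<le> 4 / 2 ^ tet 2 k * x"
  proof (rule cnt_power_multiples_le)
    show "(\<Sum>m=2..K. 1 / real m ^ tet 2 k) \<le> 4 / 2 ^ tet 2 k" for K
      using sum_inverse_powers_le[of 2 "tet 2 k" K] tet_ge_2[OF k] by simp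
  qed (use x in auto)
  finally show ?thesis .
qed

lemma Hdens_compl_le: "k \<ge> 1 \<Longrightarrow> 1 - Hdens k \<le> 4 / 2 ^ tet 2 k"
  using has_dens_le_const[OF has_dens_H_gr] cnt_H_gr_le by simp

lemma has_dens_multiplicity_eq:
  "prime p \<Longrightarrow> has_dens {n. multiplicity p n = i} ((1 - 1 / real p) / real p ^ i)"
  using has_dens_exponent[OF _ local_dens_finite[of p "{i}"]] by (simp add: diff_divide_distrib)

text \<open>By \<open>two_tet_le\<close>, height above \<open>k\<close> requires that 2 or 3 has
  exponent exactly \<open>T\<close>, or exponent at least \<open>2 * T\<close>, or that a prime from
  5 on has exponent at least \<open>T\<close>. The five summands are the densities of these events
  or bounds for them.\<close>

lemma Hdens_compl_upper:
  assumes k: "k \<ge> 2"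
  defines "T \<equiv> tet 2 k"
  shows "1 - Hdens k \<le> 1 / 2 / 2 ^ T + 1 / 2 ^ (2 * T) + 2 / 3 / 3 ^ T + 1 / 3 ^ (2 * T) + 25 / 4 / 5 ^ T"
proof -
  have T: "T \<ge> 2" unfolding T_def using tet_ge_2 k by simp
  let ?A = "\<lambda>p. {n. multiplicity p n = T}"
  let ?B = "\<lambda>M t. {n. \<exists>m\<ge>M. m ^ t dvd n}"
  let ?D = "\<lambda>p. {n. p ^ (2 * T) dvd n}"
  have mult: "cnt (?D p) x \<le> 1 / real p ^ (2 * T) * x" if "p > 0" "x \<ge> 0" for p x
  proof -
    have "{n \<in> ?D p. 1 \<le> n \<and> real n \<le> x} = {n \<in> {1..nat \<lfloor>x\<rfloor>}. p ^ (2 * T) dvd n}"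
      using that by (auto simp: le_nat_floor) linarith
    then have "cnt (?D p) x = real (nat \<lfloor>x\<rfloor> div p ^ (2 * T))"
      unfolding cnt_def using card_multiples[of "p ^ (2 * T)" "nat \<lfloor>x\<rfloor>"] that by simp
    also have "\<dots> \<le> real (nat \<lfloor>x\<rfloor>) / real (p ^ (2 * T))" by (rule of_nat_div_le_of_nat)
    also have "\<dots> \<le> x / real (p ^ (2 * T))" using that by (intro divide_right_mono) auto
    finally show ?thesis by simp
  qed
  have sub: "n \<in> (?A 2 \<union> ?A 3) \<union> (?D 2 \<union> ?D 3 \<union> ?B 5 T)" if n: "n \<ge> 1" "k < H n" for n
  proof -
    obtain p where p: "prime p" "k \<le> H (multiplicity p n)"
      using Suc_le_H_iff[of n k] k n by auto
    define a where "a = multiplicity p n"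
    have a: "a = T \<or> 2 * T \<le> a"
      using two_tet_le[OF k, of a] p unfolding a_def T_def by blast
    have dvd: "p ^ i dvd n" if "i \<le> a" for i
      using that unfolding a_def by (rule multiplicity_dvd')
    show ?thesis
    proof (cases "p = 2 \<or> p = 3")
      case True
      then show ?thesis using a dvd[of "2 * T"] a_def by auto
    next
      case False
      have "p \<noteq> 4" using p(1) by auto
      with False prime_ge_2_nat[OF p(1)] have "p \<ge> 5" by linarith
      moreover have "p ^ T dvd n" using a by (intro dvd) auto
      ultimately show ?thesis by auto
    qed
  qed
  let ?c = "1 / 2 ^ (2 * T) + 1 / 3 ^ (2 * T) + 25 / 4 / 5 ^ T :: real"
  have cnt1: "cnt {n. k < H n} x \<le> cnt (?A 2) x + cnt (?A 3) x + ?c * x" if x: "x \<ge> 1" for x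
  proof -
    have "cnt {n. k < H n} x \<le> cnt ((?A 2 \<union> ?A 3) \<union> (?D 2 \<union> ?D 3 \<union> ?B 5 T)) x"
      by (rule cnt_mono) (use sub in blast)
    also have "\<dots> \<le> cnt (?A 2) x + cnt (?A 3) x + (cnt (?D 2) x + cnt (?D 3) x + cnt (?B 5 T) x)"
      using cnt_Un_le[of "?A 2 \<union> ?A 3" "?D 2 \<union> ?D 3 \<union> ?B 5 T" x] cnt_Un_le[of "?A 2" "?A 3" x]
        cnt_Un_le[of "?D 2 \<union> ?D 3" "?B 5 T" x] cnt_Un_le[of "?D 2" "?D 3" x] by linarith
    also have "cnt (?B 5 T) x \<le> 25 / 4 / 5 ^ T * x"
    proof (rule cnt_power_multiples_le)
      show "(\<Sum>m=5..K. 1 / real m ^ T) \<le> 25 / 4 / 5 ^ T" for K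
        using sum_inverse_powers_le[of 5 T K] T by simp
    qed (use x T in auto)
    finally show ?thesis using mult[of 2 x] mult[of 3 x] x by (simp add: algebra_simps)
  qed
  have "((\<lambda>x. cnt (?A 2) x / x + cnt (?A 3) x / x + ?c) \<longlongrightarrow>
         (1 - 1 / real 2) / real 2 ^ T + (1 - 1 / real 3) / real 3 ^ T + ?c) at_top"
    using has_dens_multiplicity_eq[of 2 T] has_dens_multiplicity_eq[of 3 T]
    unfolding has_dens_def
    by (intro tendsto_add tendsto_const) simp_all
  then have "1 - Hdens k \<le> (1 - 1 / real 2) / real 2 ^ T + (1 - 1 / real 3) / real 3 ^ T + ?c"
    using has_dens_H_gr[of k] unfolding has_dens_def
  proof (rule tendsto_le[OF trivial_limit_at_top_linorder])
    show "\<forall>\<^sub>F x in at_top. cnt {n. k < H n} x / x \<le> cnt (?A 2) x / x + cnt (?A 3) x / x + ?c"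
      using eventually_ge_at_top[of 1]
    proof eventually_elim
      case (elim x)
      have "cnt {n. k < H n} x / x \<le> (cnt (?A 2) x + cnt (?A 3) x + ?c * x) / x"
        using cnt1[OF elim] elim by (intro divide_right_mono) auto
      also have "\<dots> = cnt (?A 2) x / x + cnt (?A 3) x / x + ?c"
        using elim by (simp add: add_divide_distrib)
      finally show ?case .
    qed
  qed
  then show ?thesis by simp
qed

text \<open>Since \<open>T\<close> itself has height \<open>k\<close>, numbers of height at most
  \<open>k\<close> avoid the exponent \<open>T\<close> at both 2 and 3, and these two conditions are
  independent.\<close>

lemma Hdens_compl_lower:
  assumes k: "k \<ge> 1"
  defines "T \<equiv> tet 2 k"
  shows "1 - (1 - 1 / 2 / 2 ^ T) * (1 - 2 / 3 / 3 ^ T) \<le> 1 - Hdens k"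
proof -
  have loc: "local_dens p (- {T}) (1 - (1 - 1 / real p) / real p ^ T)" if "prime p" for p
    using local_dens_Compl[OF local_dens_finite[OF that, of "{T}"]] by (simp add: diff_divide_distrib)
  have "has_dens {n. \<forall>p\<in>{2, 3}. multiplicity p n \<in> - {T}} (\<Prod>p\<in>{2, 3}. 1 - (1 - 1 / real p) / real p ^ T)"
    by (intro has_dens_exponents loc) auto
  then have "Hdens k \<le> (\<Prod>p\<in>{2, 3}. 1 - (1 - 1 / real p) / real p ^ T)"
  proof (rule has_dens_mono[OF has_dens_H_le])
    fix n :: nat assume n: "n \<ge> 1" "n \<in> {n. H n \<le> k}"
    then have "\<not> Suc k \<le> H n" by simp
    then have "\<And>p. prime p \<Longrightarrow> \<not> k \<le> H (multiplicity p n)"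
      using Suc_le_H_iff[of n k] n k by auto
    moreover have "k \<le> H T" unfolding T_def by simp
    ultimately have "\<And>p. prime p \<Longrightarrow> multiplicity p n \<noteq> T" by metis
    then show "n \<in> {n. \<forall>p\<in>{2, 3}. multiplicity p n \<in> - {T}}" by auto
  qed
  then show ?thesis by simp
qed

text \<open>The series for \<open>c1\<close> with index shifted: \<open>dev k\<close> belongs to
  height \<open>Suc k\<close>.\<close>

definition dev :: "nat \<Rightarrow> real" where
  "dev k = real (tet 2 (Suc k)) * Ddens (Suc k) - 1 / 2"

lemma dev_eq: "dev k = 2 ^ tet 2 k * ((1 - Hdens k) - (1 - Hdens (Suc k))) - 1 / 2"
  by (simp add: dev_def Ddens_Suc)

lemma two_mult_le_power: "2 * n \<le> (2::nat) ^ n"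
proof (induction n)
  case (Suc n)
  then show ?case by (cases n) auto
qed simp

text \<open>The exponent \<open>T\<close> at the prime 2 contributes the main term 1/2 of
  \<open>2 ^ T * u\<close>. All other contributions are powers with base at most 2/3, and
  \<open>v\<close> is negligible because the next tower is at least \<open>2 * T\<close>.\<close>

lemma abs_dev_le:
  assumes k: "k \<ge> 2"
  shows "\<bar>dev k\<bar> \<le> 10 * (2 / 3) ^ tet 2 k"
proof -
  define T where "T = tet 2 k"
  define u where "u = 1 - Hdens k"
  define v where "v = 1 - Hdens (Suc k)"
  define r :: real where "r = (2 / 3) ^ T"
  have r0: "r \<ge> 0" unfolding r_def by simp
  have dev: "dev k = 2 ^ T * u - 2 ^ T * v - 1 / 2"
    unfolding dev_eq T_def u_def v_def by (simp add: algebra_simps)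
  have v0: "v \<ge> 0" unfolding v_def using Hdens_le_1 by simp
  have "2 ^ T * u \<le> 2 ^ T * (1 / 2 / 2 ^ T + 1 / 2 ^ (2 * T) + 2 / 3 / 3 ^ T + 1 / 3 ^ (2 * T) + 25 / 4 / 5 ^ T)"
    unfolding u_def T_def using Hdens_compl_upper[OF k] by (intro mult_left_mono) auto
  also have "\<dots> = 1 / 2 + (1 / 2) ^ T + 2 / 3 * (2 / 3) ^ T + (2 / 9) ^ T + 25 / 4 * (2 / 5) ^ T"
    by (simp add: power_mult power_divide field_simps power_mult_distrib[symmetric]
        power2_eq_square flip: power_add)
  also have "\<dots> \<le> 1 / 2 + r + 2 / 3 * r + r + 25 / 4 * r"
    unfolding r_def by (intro add_mono mult_left_mono power_mono) auto
  \<comment> \<open>The coefficients add up to \<open>1 + 2/3 + 1 + 25/4\<close>, which is less than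
    9.\<close>
  finally have upper: "2 ^ T * u - 1 / 2 \<le> 9 * r" using r0 by linarith
  have "1 / 2 / 2 ^ T \<le> u"
  proof -
    have "(1::real) \<le> 2 ^ T" by simp
    then have "1 / 2 / 2 ^ T \<le> (1::real)" by (simp add: divide_simps del: one_le_power)
    then have "(1 - 1 / 2 / 2 ^ T) * (1 - 2 / 3 / 3 ^ T) \<le> (1 - 1 / 2 / 2 ^ T) * (1::real)"
      by (intro mult_left_mono) auto
    then show ?thesis using Hdens_compl_lower[of k] k unfolding u_def T_def by simp
  qed
  then have lower: "1 / 2 \<le> 2 ^ T * u" by (simp add: field_simps)
  have "v \<le> 4 / 2 ^ tet 2 (Suc k)" unfolding v_def by (rule Hdens_compl_le) simp
  also have "\<dots> \<le> 4 / 2 ^ (2 * T)"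
    using two_mult_le_power[of T] unfolding T_def by (intro divide_left_mono power_increasing) auto
  finally have "2 ^ T * v \<le> 2 ^ T * (4 / 2 ^ (2 * T))" by (intro mult_left_mono) auto
  also have "\<dots> = 4 * (1 / 2) ^ T"
    by (simp add: power_divide mult_2 power_add)
  also have "\<dots> \<le> 4 * r" unfolding r_def by (intro mult_left_mono power_mono) auto
  finally have "2 ^ T * v \<le> 4 * r" .
  moreover have "0 \<le> 2 ^ T * v" using v0 by simp
  ultimately show ?thesis using dev upper lower r0 unfolding r_def T_def by linarith
qed

lemma abs_dev_le_all: "\<exists>C\<ge>0. \<forall>k. \<bar>dev k\<bar> \<le> C * (2 / 3) ^ tet 2 k"
\<comment> \<open>The factors 3/2 and 9/4 invert \<open>(2 / 3) ^ tet 2 k\<close> for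
  \<open>k = 0\<close> and \<open>k = 1\<close>, where the tower is 1 and 2.\<close>
proof (intro exI[of _ "10 + 3 / 2 * \<bar>dev 0\<bar> + 9 / 4 * \<bar>dev 1\<bar>"] conjI allI)
  fix k :: nat
  let ?C = "10 + 3 / 2 * \<bar>dev 0\<bar> + 9 / 4 * \<bar>dev 1\<bar>"
  consider "k = 0" | "k = 1" | "k \<ge> 2" by linarith
  then show "\<bar>dev k\<bar> \<le> ?C * (2 / 3) ^ tet 2 k"
  proof cases
    case 3
    have "\<bar>dev k\<bar> \<le> 10 * (2 / 3) ^ tet 2 k" using abs_dev_le[OF 3] .
    also have "\<dots> \<le> ?C * (2 / 3) ^ tet 2 k" by (intro mult_right_mono) auto
    finally show ?thesis .
  qed (simp_all add: power2_eq_square)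
qed simp

text \<open>Since \<open>tet 2 (j + L) >= tet 2 L + j\<close>, a geometric series of ratio 2/3 and
  sum 3 dominates. The hypothesis concerns only \<open>k >= L\<close>, so the explicit constant 10
  can be used in the numerical evaluation.\<close>

lemma sums_dev_tail_bound:
  assumes C: "C \<ge> 0" "\<And>k. k \<ge> L \<Longrightarrow> \<bar>dev k\<bar> \<le> C * (2 / 3) ^ tet 2 k"
  shows "summable dev" and "\<bar>\<Sum>j. dev (j + L)\<bar> \<le> 3 * C * (2 / 3) ^ tet 2 L"
proof -
  let ?g = "\<lambda>j::nat. C * (2 / 3) ^ tet 2 L * (2 / 3 :: real) ^ j"
  have g: "?g sums (C * (2 / 3) ^ tet 2 L * (1 / (1 - 2 / 3)))"
    by (intro sums_mult geometric_sums) simp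
  have le: "norm (dev (j + L)) \<le> ?g j" for j
  proof -
    have "norm (dev (j + L)) \<le> C * (2 / 3) ^ tet 2 (j + L)" using C(2)[of "j + L"] by simp
    also have "\<dots> \<le> C * (2 / 3) ^ (tet 2 L + j)"
      using C(1) tet_add_le[of L j] by (intro mult_left_mono power_decreasing) (auto simp: add.commute)
    finally show ?thesis by (simp add: power_add mult.assoc)
  qed
  have summ: "summable (\<lambda>j. norm (dev (j + L)))"
    by (rule summable_comparison_test'[OF sums_summable[OF g], of 0]) (use le in auto)
  then have "summable (\<lambda>j. dev (j + L))" by (rule summable_norm_cancel)
  then show "summable dev" by (simp add: summable_iff_shift)
  have "\<bar>\<Sum>j. dev (j + L)\<bar> \<le> (\<Sum>j. norm (dev (j + L)))" using summable_norm[OF summ] by simp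
  also have "\<dots> \<le> suminf ?g" using le summ sums_summable[OF g] by (intro suminf_le) auto
  also have "\<dots> = 3 * C * (2 / 3) ^ tet 2 L" using sums_unique[OF g] by simp
  finally show "\<bar>\<Sum>j. dev (j + L)\<bar> \<le> 3 * C * (2 / 3) ^ tet 2 L" .
qed

lemma summable_dev: "summable dev"
  using abs_dev_le_all sums_dev_tail_bound(1)[of _ 0] by blast

lemma c1_eq: "c1 = (\<Sum>k<L. dev k) + (\<Sum>j. dev (j + L))"
proof -
  have "c1 = suminf dev" unfolding c1_def dev_def ..
  then show ?thesis using suminf_split_initial_segment[OF summable_dev, of L] by simp
qed

section \<open>Asymptotics\<close>

lemma logstar_eq:
  assumes "1 \<le> m" "real (tet 2 m) \<le> x" "x < real (tet 2 (m + 1))"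
  shows "logstar x = m"
  unfolding logstar_def
proof (rule the_equality)
  fix l assume l: "1 \<le> l \<and> real (tet 2 l) \<le> x \<and> x < real (tet 2 (l + 1))"
  have "real (tet 2 l) < real (tet 2 (m + 1))" "real (tet 2 m) < real (tet 2 (l + 1))"
    using l assms by linarith+
  then have "l < m + 1" "m < l + 1"
    unfolding of_nat_less_iff strict_mono_less[OF strict_mono_tet] by auto
  then show "l = m" by simp
qed (use assms in simp)

text \<open>The predecessor of the least \<open>n\<close> with \<open>x < tet 2 n\<close> satisfies
  the description in \<open>logstar\<close>.\<close>

lemma logstar_bounds:
  assumes "x \<ge> 2"
  shows "1 \<le> logstar x" "real (tet 2 (logstar x)) \<le> x" "x < real (tet 2 (logstar x + 1))"
proof -
  define n where "n = (LEAST n. x < real (tet 2 n))"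
  have "x < real (tet 2 (nat \<lceil>x\<rceil>))"
  proof -
    have "x \<le> real (nat \<lceil>x\<rceil>)" using assms by linarith
    also have "\<dots> < real (tet 2 (nat \<lceil>x\<rceil>))" using tet_add_le[of 0 "nat \<lceil>x\<rceil>"] by simp
    finally show ?thesis .
  qed
  then have n: "x < real (tet 2 n)" unfolding n_def by (rule LeastI)
  have "n \<noteq> 0" "n \<noteq> 1" using n assms by (intro notI; simp)+
  then obtain m where m: "n = m + 1" "m \<ge> 1"
    by (intro that[of "n - 1"]) auto
  have "\<not> x < real (tet 2 m)" using not_less_Least[of m "\<lambda>n. x < real (tet 2 n)"] m n_def by auto
  then have "logstar x = m" using logstar_eq[of m x] m n by simp
  then show "1 \<le> logstar x" "real (tet 2 (logstar x)) \<le> x" "x < real (tet 2 (logstar x + 1))"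
    using m n \<open>\<not> x < real (tet 2 m)\<close> by auto
qed

text \<open>With \<open>y = ln x\<close>, this absorbs the powers 0 and 1 of the logarithm into the
  stated error term. The 8 is \<open>2 ^ 3\<close>, from scaling \<open>y\<close> to
  \<open>2 * y >= 1\<close>.\<close>

lemma le_ln_powr:
  fixes y :: real
  assumes "y \<ge> 1 / 2"
  shows "1 \<le> 8 * y powr (9/4)" and "y \<le> 8 * y powr (9/4)"
proof -
  have "(2::real) powr (9/4) \<le> 2 powr 3" by (rule powr_mono) auto
  then have *: "(2 * y) powr (9/4) \<le> 8 * y powr (9/4)"
    using assms by (simp add: powr_mult mult_right_mono)
  have "1 \<le> (2 * y) powr (9/4)" using assms by (intro ge_one_powr_ge_zero) auto
  with * show "1 \<le> 8 * y powr (9/4)" by linarith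
  have "(2 * y) powr 1 \<le> (2 * y) powr (9/4)" using assms by (intro powr_mono) auto
  with * assms show "y \<le> 8 * y powr (9/4)" by simp
qed

text \<open>\<open>(2 / 3) ^ T\<close> is \<open>2 ^ T\<close> raised to the negative exponent
  \<open>1 - ln 3 / ln 2\<close>, so replacing \<open>2 ^ T\<close> by the smaller \<open>x\<close>
  increases it.\<close>

lemma mult_two_thirds_power_le:
  fixes x :: real
  assumes x: "x \<ge> 1" "x \<le> 2 ^ T"
  shows "x * (2 / 3) ^ T \<le> x powr (2 - ln 3 / ln 2)"
proof -
  have l2: "ln (2::real) > 0" by simp
  have "(2 / 3 :: real) ^ T = (2 ^ T) powr (1 - ln 3 / ln 2)"
  proof -
    have "(2 ^ T :: real) powr (1 - ln 3 / ln 2) = exp ((1 - ln 3 / ln 2) * (real T * ln 2))"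
      by (simp add: powr_def ln_realpow)
    also have "(1 - ln 3 / ln 2) * (real T * ln 2) = real T * ln (2 / 3)"
      using l2 by (simp add: ln_div field_simps)
    also have "exp (real T * ln (2 / 3)) = (2 / 3 :: real) ^ T"
      by (simp add: exp_of_nat_mult)
    finally show ?thesis ..
  qed
  also have "\<dots> \<le> x powr (1 - ln 3 / ln 2)"
    using x l2 by (intro powr_mono2') (auto simp: field_simps)
  finally have "x * (2 / 3) ^ T \<le> x powr 1 * x powr (1 - ln 3 / ln 2)"
    using x by (simp add: mult_left_mono)
  also have "\<dots> = x powr (2 - ln 3 / ln 2)" unfolding powr_add[symmetric] by simp
  finally show ?thesis .
qed

text \<open>The exponent is at most 1/2 because \<open>2 ^ 3 <= 3 ^ 2\<close>.\<close>

lemma powr_Delta_le_sqrt: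
  fixes x :: real
  assumes "x \<ge> 1"
  shows "x powr (2 - ln 3 / ln 2) \<le> sqrt x"
proof -
  have "3 * ln 2 = ln ((2::real) ^ 3)" by (subst ln_realpow) auto
  also have "\<dots> \<le> ln (3 ^ 2)" by (subst ln_le_cancel_iff) auto
  also have "\<dots> = 2 * ln (3::real)" by (subst ln_realpow) auto
  finally have "2 - ln 3 / ln 2 \<le> (1 / 2 :: real)" by (simp add: field_simps)
  then have "x powr (2 - ln 3 / ln 2) \<le> x powr (1 / 2)" using assms by (rule powr_mono)
  then show ?thesis using assms by (simp add: powr_half_sqrt)
qed

text \<open>Logarithms of \<open>2 ^ tet 2 l <= x\<close>, with \<open>ln 2 >= 1/2\<close>. For
  \<open>Suc l = logstar x\<close> it bounds the largest weight below the top level.\<close>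

lemma tet_le_2_ln:
  assumes "real (tet 2 (Suc l)) \<le> x"
  shows "real (tet 2 l) \<le> 2 * ln x"
proof -
  have "0 < real (tet 2 (Suc l))" using tet_pos by (simp del: tet.simps)
  moreover from this assms have "0 < x" by linarith
  ultimately have "ln (real (tet 2 (Suc l))) \<le> ln x" using assms by (simp only: ln_le_cancel_iff)
  then have "real (tet 2 l) * ln 2 \<le> ln x" by (simp add: ln_realpow)
  moreover have "real (tet 2 l) * (1 / 2) \<le> real (tet 2 l) * ln 2"
    using ln2_ge_two_thirds by (intro mult_left_mono) auto
  ultimately show ?thesis by linarith
qed

text \<open>Towers at least double at each step, so the last weight dominates the sum.\<close>

lemma sum_tet_le: "(\<Sum>k<l. real (tet 2 (Suc k))) \<le> 2 * real (tet 2 l)"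
proof (induction l)
  case (Suc l)
  have "real (2 * tet 2 l) \<le> real (2 ^ tet 2 l)" using two_mult_le_power[of "tet 2 l"] by (simp only: of_nat_le_iff)
  with Suc show ?case by simp
qed simp

text \<open>Grouping by height is finite: \<open>n <= x\<close> has height at most
  \<open>logstar x\<close> because \<open>tet 2 (H n) <= n\<close>.\<close>

lemma calH_eq:
  assumes "x \<ge> 2" "logstar x = Suc l"
  shows "calH x = Dcount 0 x + (\<Sum>k<Suc l. real (tet 2 (Suc k)) * Dcount (Suc k) x)"
proof -
  let ?S = "{n::nat. 1 \<le> n \<and> real n \<le> x}"
  have fin: "finite ?S" using finite_nat_le_real[of UNIV x] by simp
  have sub: "H ` ?S \<subseteq> {..Suc l}"
  proof (rule image_subsetI)
    fix n assume "n \<in> ?S"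
    then have n: "1 \<le> n" "real n \<le> x" by auto
    have "real (tet 2 (H n)) \<le> real n" using tet_H_le[of n] n by simp
    also have "\<dots> < real (tet 2 (Suc l + 1))"
      using n logstar_bounds(3)[OF assms(1)] unfolding assms(2) by linarith
    finally have "H n < Suc l + 1"
      unfolding of_nat_less_iff strict_mono_less[OF strict_mono_tet] .
    then show "H n \<in> {..Suc l}" by simp
  qed
  have "calH x = (\<Sum>k\<in>{..Suc l}. \<Sum>n\<in>{n \<in> ?S. H n = k}. real (tet 2 (H n)))"
    unfolding calH_def using sum.group[OF fin _ sub, of "\<lambda>n. real (tet 2 (H n))"] by simp
  also have "\<dots> = (\<Sum>k\<in>{..Suc l}. real (tet 2 k) * Dcount k x)"
  proof (rule sum.cong)
    fix k
    have "(\<Sum>n\<in>{n \<in> ?S. H n = k}. real (tet 2 (H n))) = (\<Sum>n\<in>{n \<in> ?S. H n = k}. real (tet 2 k))"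
      by (rule sum.cong) auto
    then show "(\<Sum>n\<in>{n \<in> ?S. H n = k}. real (tet 2 (H n))) = real (tet 2 k) * Dcount k x"
      by (simp add: Dcount_def conj_assoc)
  qed simp
  also have "\<dots> = Dcount 0 x + (\<Sum>k<Suc l. real (tet 2 (Suc k)) * Dcount (Suc k) x)"
    unfolding lessThan_Suc_atMost[symmetric] by (subst sum.lessThan_Suc_shift) simp
  finally show ?thesis .
qed

lemma Dcount_0_le: "Dcount 0 x \<le> 1"
proof -
  have "{n. 1 \<le> n \<and> real n \<le> x \<and> H n = 0} \<subseteq> {1}" using H_eq_0_iff by auto
  then have "card {n. 1 \<le> n \<and> real n \<le> x \<and> H n = 0} \<le> card {1::nat}" by (intro card_mono) auto
  then show ?thesis by (simp add: Dcount_def)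
qed

text \<open>Replacing counts by densities leaves the number 1, the \<open>sqrt x\<close> errors
  below the top level, the top-level error \<open>H1 x\<close>, and the part of the series for
  \<open>c1\<close> beyond the top level.\<close>

lemma calH_asymptotics:
  "\<exists>C. \<forall>x::real. x \<ge> 2 \<longrightarrow>
     \<bar>calH x - (x * real (logstar x) / 2 + c1 * x + H1 x)\<bar> \<le> C * sqrt x * ln x powr (9/4)"
proof -
  obtain B where B: "B \<ge> 0"
    "\<And>k x. x \<ge> 1 \<Longrightarrow> \<bar>Dcount (Suc k) x - x * Ddens (Suc k)\<bar> \<le> B * sqrt x"
    using Dcount_bound by blast
  obtain C where C: "C \<ge> 0" "\<And>k. \<bar>dev k\<bar> \<le> C * (2 / 3) ^ tet 2 k"
    using abs_dev_le_all by blast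
  show ?thesis
  \<comment> \<open>8 absorbs the number 1, \<open>32 * B\<close> the levels below the top,
    \<open>24 * C\<close> the tail of the series.\<close>
  proof (intro exI[of _ "8 + 32 * B + 24 * C"] allI impI)
    fix x :: real assume x: "x \<ge> 2"
    obtain l where l: "logstar x = Suc l" using logstar_bounds(1)[OF x] by (cases "logstar x") auto
    have tx: "real (tet 2 (Suc l)) \<le> x" "x < 2 ^ tet 2 (Suc l)"
      using logstar_bounds(2,3)[OF x] l by auto
    define E where "E = (\<lambda>k. real (tet 2 (Suc k)) * (Dcount (Suc k) x - x * Ddens (Suc k)))"
    have dens: "(\<Sum>k<Suc l. real (tet 2 (Suc k)) * (x * Ddens (Suc k))) =
          x * real (Suc l) / 2 + x * (\<Sum>k<Suc l. dev k)"
    proof -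
      have "(\<Sum>k<Suc l. real (tet 2 (Suc k)) * (x * Ddens (Suc k))) = (\<Sum>k<Suc l. x * (dev k + 1 / 2))"
        by (intro sum.cong) (auto simp: dev_def)
      then show ?thesis by (simp add: sum_distrib_left[symmetric] sum.distrib distrib_left mult.commute del: sum.lessThan_Suc)

    qed
    have "calH x = Dcount 0 x + (\<Sum>k<Suc l. E k) +
            (\<Sum>k<Suc l. real (tet 2 (Suc k)) * (x * Ddens (Suc k)))"
      unfolding calH_eq[OF x l] E_def sum.distrib[symmetric] add.assoc
      by (intro arg_cong2[where f = "(+)"] sum.cong) (auto simp: algebra_simps)
    \<comment> \<open>The summand \<open>k = l\<close> is kept as \<open>H1 x\<close>: its weight
      can be as large as \<open>x\<close>, too large for the \<open>sqrt x\<close> estimate.\<close>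
    also have "(\<Sum>k<Suc l. E k) = (\<Sum>k<l. E k) + H1 x"
      unfolding H1_def l E_def by simp
    finally have calH: "calH x = Dcount 0 x + (\<Sum>k<l. E k) + H1 x + x * real (Suc l) / 2 + x * (\<Sum>k<Suc l. dev k)"
      unfolding dens by simp
    have c1: "c1 * x = x * (\<Sum>k<Suc l. dev k) + x * (\<Sum>j. dev (j + Suc l))"
      unfolding c1_eq[of "Suc l"] by (simp add: algebra_simps)
    have diff: "calH x - (x * real (logstar x) / 2 + c1 * x + H1 x) =
          Dcount 0 x + (\<Sum>k<l. E k) - x * (\<Sum>j. dev (j + Suc l))"
      unfolding calH c1 l by simp
    let ?R = "sqrt x * ln x powr (9/4)"
    have sq: "1 \<le> sqrt x" using x by simp
    have "ln x \<ge> ln 2" using x by (subst ln_le_cancel_iff) auto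
    then have lnx: "ln x \<ge> 1 / 2" using ln2_ge_two_thirds by linarith
    have R1: "sqrt x \<le> 8 * ?R"
      using mult_left_mono[OF le_ln_powr(1)[OF lnx], of "sqrt x"] sq by (simp add: mult_ac)
    have R2: "sqrt x * ln x \<le> 8 * ?R"
      using mult_left_mono[OF le_ln_powr(2)[OF lnx], of "sqrt x"] sq by (simp add: mult_ac)
    have "\<bar>\<Sum>k<l. E k\<bar> \<le> (\<Sum>k<l. real (tet 2 (Suc k)) * (B * sqrt x))"
    proof (rule order_trans[OF sum_abs], rule sum_mono)
      fix k
      show "\<bar>E k\<bar> \<le> real (tet 2 (Suc k)) * (B * sqrt x)"
        unfolding E_def abs_mult using B(2)[of x k] x by (intro mult_mono) auto
    qed
    also have "\<dots> = (\<Sum>k<l. real (tet 2 (Suc k))) * (B * sqrt x)" by (simp add: sum_distrib_right)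
    also have "\<dots> \<le> (2 * (2 * ln x)) * (B * sqrt x)"
      using sum_tet_le[of l] tet_le_2_ln[OF tx(1)] B(1) sq
      by (intro mult_right_mono) auto
    also have "\<dots> = 4 * B * (sqrt x * ln x)" by simp
    also have "\<dots> \<le> 4 * B * (8 * ?R)" using R2 B(1) by (intro mult_left_mono) auto
    finally have E: "\<bar>\<Sum>k<l. E k\<bar> \<le> 32 * B * ?R" by simp
    have "\<bar>x * (\<Sum>j. dev (j + Suc l))\<bar> \<le> x * (3 * C * (2 / 3) ^ tet 2 (Suc l))"
      unfolding abs_mult using sums_dev_tail_bound(2)[of C "Suc l"] C x by (intro mult_mono) auto
    also have "\<dots> = 3 * C * (x * (2 / 3) ^ tet 2 (Suc l))" by simp
    also have "\<dots> \<le> 3 * C * (8 * ?R)"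
    proof (intro mult_left_mono)
      have "x * (2 / 3) ^ tet 2 (Suc l) \<le> x powr (2 - ln 3 / ln 2)"
        using x tx by (intro mult_two_thirds_power_le) auto
      also have "\<dots> \<le> sqrt x" using x by (intro powr_Delta_le_sqrt) auto
      finally show "x * (2 / 3) ^ tet 2 (Suc l) \<le> 8 * ?R" using R1 by linarith
    qed (use C in auto)
    finally have tail: "\<bar>x * (\<Sum>j. dev (j + Suc l))\<bar> \<le> 24 * C * ?R" by simp
    have "0 \<le> Dcount 0 x" by (simp add: Dcount_def)
    then have "\<bar>Dcount 0 x\<bar> \<le> 8 * ?R" using Dcount_0_le[of x] R1 sq by linarith
    then have "\<bar>calH x - (x * real (logstar x) / 2 + c1 * x + H1 x)\<bar> \<le> 8 * ?R + 32 * B * ?R + 24 * C * ?R"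
      unfolding diff using E tail by linarith
    then show "\<bar>calH x - (x * real (logstar x) / 2 + c1 * x + H1 x)\<bar> \<le>
        (8 + 32 * B + 24 * C) * sqrt x * ln x powr (9/4)"
      by (simp add: algebra_simps)
  qed
qed

text \<open>The count and the density are bounded separately, each being \<open>O(x)\<close> after
  multiplication by the weight; for the count this rests on \<open>cnt_H_gr_le\<close>.\<close>

lemma H1_linear_bound: "\<exists>C. \<forall>x::real. x \<ge> 2 \<longrightarrow> \<bar>H1 x\<bar> \<le> C * x"
proof -
  obtain C where C: "C \<ge> 0" "\<And>k. \<bar>dev k\<bar> \<le> C * (2 / 3) ^ tet 2 k"
    using abs_dev_le_all by blast
  show ?thesis
  proof (intro exI[of _ "5 + C"] allI impI)
    fix x :: real assume x: "x \<ge> 2"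
    obtain l where l: "logstar x = Suc l" using logstar_bounds(1)[OF x] by (cases "logstar x") auto
    have H1: "H1 x = real (tet 2 (Suc l)) * Dcount (Suc l) x - x * (dev l + 1 / 2)"
      unfolding H1_def l dev_def by (simp add: algebra_simps)
    have le: "Dcount (Suc l) x \<le> cnt {n. l < H n} x"
    proof -
      have "Dcount (Suc l) x = cnt {n. H n = Suc l} x"
        unfolding Dcount_def cnt_def by (intro arg_cong[where f = real] arg_cong[where f = card]) auto
      also have "\<dots> \<le> cnt {n. l < H n} x" by (rule cnt_mono) auto
      finally show ?thesis .
    qed
    have count: "real (tet 2 (Suc l)) * Dcount (Suc l) x \<le> 4 * x"
    proof (cases "l = 0")
      case True
      then show ?thesis using le cnt_le[of x "{n. l < H n}"] x by simp
    next
      case False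
      have "Dcount (Suc l) x \<le> 4 / 2 ^ tet 2 l * x"
        using le cnt_H_gr_le[of l x] False x by simp
      then have "2 ^ tet 2 l * Dcount (Suc l) x \<le> 2 ^ tet 2 l * (4 / 2 ^ tet 2 l * x)"
        by (intro mult_left_mono) auto
      then show ?thesis by simp
    qed
    have "0 \<le> real (tet 2 (Suc l)) * Dcount (Suc l) x" by (simp add: Dcount_def)
    moreover have "\<bar>x * (dev l + 1 / 2)\<bar> \<le> x * (C + 1)"
    proof -
      have "C * (2 / 3) ^ tet 2 l \<le> C * 1" using C(1) by (intro mult_left_mono power_le_one) auto
      then have "\<bar>dev l + 1 / 2\<bar> \<le> C + 1" using C(2)[of l] by linarith
      then show ?thesis unfolding abs_mult using x by (intro mult_mono) auto
    qed
    ultimately show "\<bar>H1 x\<bar> \<le> (5 + C) * x" using H1 count by (simp add: algebra_simps)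
  qed
qed

text \<open>Just below a tower the top weight is only \<open>tet 2 (N - 1)\<close>, the binary
  logarithm of \<open>x + 1\<close>, so the \<open>sqrt x\<close> error stays admissible.\<close>

lemma H1_before_tet_bound:
  "\<exists>C. \<forall>N::nat. \<forall>x::real. x = real (tet 2 N) - 1 \<longrightarrow> x \<ge> 2 \<longrightarrow>
     \<bar>H1 x\<bar> \<le> C * sqrt x * ln x powr (9/4)"
proof -
  obtain B where B: "B \<ge> 0"
    "\<And>k x. x \<ge> 1 \<Longrightarrow> \<bar>Dcount (Suc k) x - x * Ddens (Suc k)\<bar> \<le> B * sqrt x"
    using Dcount_bound by blast
  show ?thesis
  proof (intro exI[of _ "32 * B"] allI impI)
    fix N :: nat and x :: real
    assume xN: "x = real (tet 2 N) - 1" and x: "x \<ge> 2"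
    \<comment> \<open>For these \<open>N\<close> the value of \<open>x\<close> would be 0 or
      1.\<close>
    have "N \<noteq> 0" "N \<noteq> 1" using xN x by (intro notI; simp)+
    then obtain m where m: "N = Suc (Suc m)" by (metis One_nat_def not0_implies_Suc)
    have "2 * tet 2 (Suc m) \<le> tet 2 N" unfolding m using two_mult_le_power[of "tet 2 (Suc m)"] by simp
    moreover have "tet 2 (Suc m) \<ge> 1" using tet_pos[of "Suc m"] by simp
    ultimately have "tet 2 (Suc m) + 1 \<le> tet 2 N" by linarith
    then have "real (tet 2 (Suc m)) + 1 \<le> real (tet 2 N)" by (metis of_nat_1 of_nat_add of_nat_le_iff)
    then have L: "logstar x = Suc m" using xN m by (intro logstar_eq) auto
    have "ln x \<ge> ln 2" using x by (subst ln_le_cancel_iff) auto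
    then have lnx: "ln x \<ge> 1 / 2" using ln2_ge_two_thirds by linarith
    have "real (tet 2 (Suc m)) \<le> 2 * ln (x + 1)" using xN m by (intro tet_le_2_ln) simp
    also have "ln (x + 1) \<le> ln (x * x)"
    proof -
      have "2 * x \<le> x * x" using x by (intro mult_right_mono) auto
      then have "x + 1 \<le> x * x" using x by linarith
      then show ?thesis using x by (simp add: ln_le_cancel_iff)
    qed
    also have "ln (x * x) = 2 * ln x" using x by (simp add: ln_mult)
    finally have t: "real (tet 2 (Suc m)) \<le> 4 * ln x" by simp
    have "\<bar>H1 x\<bar> \<le> (4 * ln x) * (B * sqrt x)"
      unfolding H1_def L abs_mult using t B(2)[of x m] x lnx by (intro mult_mono) auto
    also have "\<dots> \<le> (4 * (8 * ln x powr (9/4))) * (B * sqrt x)"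
      using le_ln_powr(2)[OF lnx] B(1) x by (intro mult_right_mono) auto
    finally show "\<bar>H1 x\<bar> \<le> 32 * B * sqrt x * ln x powr (9/4)" by (simp add: mult_ac)
  qed
qed

text \<open>At \<open>x = tet 2 N\<close> the only number of height \<open>N\<close> counted is
  \<open>x\<close> itself. Its weight \<open>x\<close>, minus the main term
  \<open>x * (dev m + 1 / 2)\<close>, leaves \<open>x / 2\<close> up to
  \<open>x * dev m\<close>.\<close>

lemma H1_at_tet_bound:
  "\<exists>C. \<forall>N::nat. \<forall>x::real. x = real (tet 2 N) \<longrightarrow> x \<ge> 2 \<longrightarrow>
     \<bar>H1 x - x / 2\<bar> \<le> C * x powr (2 - ln 3 / ln 2)"
proof -
  obtain C where C: "C \<ge> 0" "\<And>k. \<bar>dev k\<bar> \<le> C * (2 / 3) ^ tet 2 k"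
    using abs_dev_le_all by blast
  show ?thesis
  proof (intro exI[of _ C] allI impI)
    fix N :: nat and x :: real
    assume xN: "x = real (tet 2 N)" and x: "x \<ge> 2"
    have "N \<noteq> 0" using xN x by (intro notI) simp
    then obtain m where m: "N = Suc m" by (metis not0_implies_Suc)
    have "tet 2 N < tet 2 (N + 1)" using strict_mono_tet by (simp add: strict_mono_less del: tet.simps)
    then have L: "logstar x = N" using xN m by (intro logstar_eq) (auto simp del: tet.simps)
    have "{n. 1 \<le> n \<and> real n \<le> x \<and> H n = N} = {tet 2 N}"
      using xN tet_le_of_le_H[of _ N] tet_pos[of N] by (auto simp: Suc_le_eq intro: antisym simp del: tet.simps)
    then have "Dcount N x = 1" by (simp add: Dcount_def)
    then have "H1 x = x - x * (dev m + 1 / 2)"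
      unfolding H1_def L dev_def using xN m by (simp add: algebra_simps)
    then have "H1 x - x / 2 = - (x * dev m)" by (simp add: algebra_simps)
    then have "\<bar>H1 x - x / 2\<bar> = x * \<bar>dev m\<bar>" using x by (simp add: abs_mult)
    also have "\<dots> \<le> x * (C * (2 / 3) ^ tet 2 m)" using C(2) x by (intro mult_left_mono) auto
    also have "\<dots> = C * (x * (2 / 3) ^ tet 2 m)" by simp
    also have "\<dots> \<le> C * x powr (2 - ln 3 / ln 2)"
      using C(1) x xN m by (intro mult_left_mono mult_two_thirds_power_le) auto
    finally show "\<bar>H1 x - x / 2\<bar> \<le> C * x powr (2 - ln 3 / ln 2)" .
  qed
qed

section \<open>The density of squarefree integers\<close>

lemma square_part_mult_square:
  fixes a b :: nat
  assumes b: "squarefree b" and a: "a > 0"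
  shows "square_part (b * a ^ 2) = a"
proof (rule dvd_antisym)
  have b0: "b \<noteq> 0" using b not_squarefree_0 by metis
  show "a dvd square_part (b * a ^ 2)" by (simp add: dvd_square_part_iff)
  show "square_part (b * a ^ 2) dvd a"
  proof (rule multiplicity_le_imp_dvd)
    fix p :: nat assume p: "prime p"
    have "multiplicity p b \<le> 1"
      using b b0 p by (simp add: squarefree_factorial_semiring'')
    moreover have "multiplicity p (b * a ^ 2) = multiplicity p b + 2 * multiplicity p a"
      using p a b0 by (simp add: prime_elem_multiplicity_mult_distrib prime_elem_multiplicity_power_distrib)
    ultimately show "multiplicity p (square_part (b * a ^ 2)) \<le> multiplicity p a"
      using p by (simp add: prime_multiplicity_square_part)
  qed (use b0 a in auto)
qed

text \<open>Every \<open>n <= N\<close> is uniquely \<open>b * a ^ 2\<close> with \<open>b\<close>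
  squarefree; the summand for \<open>a\<close> counts the \<open>n\<close> with square part
  \<open>a\<close>.\<close>

lemma sum_cnt_squarefree:
  "(\<Sum>a\<in>{1..N}. cnt {n. H n \<le> 1} (real N / real a ^ 2)) = real N"
proof -
  have sub: "square_part ` {1..N} \<subseteq> {1..N}"
  proof (rule image_subsetI)
    fix n assume n: "n \<in> {1..N}"
    have "square_part n dvd n"
      using square_part_square_dvd[of n] by (metis dvd_mult_left power2_eq_square)
    moreover have "square_part n > 0" using n
      by (metis atLeastAtMost_iff gr0I not_one_le_zero square_part_0_iff)
    ultimately show "square_part n \<in> {1..N}" using n by (auto dest: dvd_imp_le simp: Suc_le_eq)
  qed
  have "(\<Sum>a\<in>{1..N}. cnt {n. H n \<le> 1} (real N / real a ^ 2)) =
        (\<Sum>a\<in>{1..N}. \<Sum>n\<in>{n \<in> {1..N}. square_part n = a}. 1)"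
  proof (rule sum.cong)
    fix a assume a: "a \<in> {1..N}"
    let ?B = "{b \<in> {n. H n \<le> 1}. 1 \<le> b \<and> real b \<le> real N / real a ^ 2}"
    have le_iff: "real b \<le> real N / real a ^ 2 \<longleftrightarrow> b * a ^ 2 \<le> N" for b
    proof -
      have "real b \<le> real N / real a ^ 2 \<longleftrightarrow> real (b * a ^ 2) \<le> real N"
        using a by (simp add: pos_le_divide_eq)
      then show ?thesis by (simp only: of_nat_le_iff)
    qed
    have "{n \<in> {1..N}. square_part n = a} = (\<lambda>b. b * a ^ 2) ` ?B"
    proof (intro equalityI subsetI)
      fix n assume n: "n \<in> {n \<in> {1..N}. square_part n = a}"
      then have dec: "n = squarefree_part n * a ^ 2" using squarefree_decompose[of n] by auto
      have "squarefree_part n > 0" by (metis neq0_conv squarefree_part_nonzero)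
      moreover have "H (squarefree_part n) \<le> 1"
        using H_le_1_iff_squarefree[OF \<open>squarefree_part n > 0\<close>] squarefree_squarefree_part by blast
      moreover have "squarefree_part n * a ^ 2 \<le> N" using n dec by auto
      ultimately show "n \<in> (\<lambda>b. b * a ^ 2) ` ?B"
        using dec by (intro image_eqI[of _ _ "squarefree_part n"]) (auto simp: le_iff)
    next
      fix n assume "n \<in> (\<lambda>b. b * a ^ 2) ` ?B"
      then obtain b where b: "n = b * a ^ 2" "H b \<le> 1" "1 \<le> b" "b * a ^ 2 \<le> N"
        using le_iff by auto
      then have "squarefree b" using H_le_1_iff_squarefree[of b] by auto
      then show "n \<in> {n \<in> {1..N}. square_part n = a}"
        using b a square_part_mult_square[of b a] by (auto simp: Suc_le_eq)
    qed
    moreover have "inj_on (\<lambda>b. b * a ^ 2) ?B" using a by (auto intro: inj_onI)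
    ultimately have "card {n \<in> {1..N}. square_part n = a} = card ?B" by (simp only: card_image)
    then show "cnt {n. H n \<le> 1} (real N / real a ^ 2) =
               (\<Sum>n\<in>{n \<in> {1..N}. square_part n = a}. 1)"
      unfolding cnt_def by simp
  qed simp
  also have "\<dots> = (\<Sum>n\<in>{1..N}. 1)" by (rule sum.group) (use sub in auto)
  finally show ?thesis by simp
qed

text \<open>Dividing \<open>sum_cnt_squarefree\<close> by \<open>N\<close> and letting
  \<open>N\<close> grow gives \<open>q * (pi ^ 2 / 6) = 1\<close>. The interchange of limits is
  justified by truncating at \<open>K\<close>: the remaining terms are nonnegative and sum to at
  most \<open>1 / K\<close>.\<close>

lemma Hdens_1: "Hdens 1 = 6 / pi ^ 2"
proof -
  define q where "q = Hdens 1"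
  define Q where "Q = cnt {n. H n \<le> 1}"
  define z where "z = (\<lambda>K. \<Sum>a\<in>{1..K}. 1 / real a ^ 2)"
  have term_lim: "(\<lambda>N. Q (real N / real a ^ 2) / real N) \<longlonglongrightarrow> q / real a ^ 2" if a: "a \<ge> 1" for a
  proof -
    have a2: "real a ^ 2 > 0" using a by simp
    have "filterlim (\<lambda>N. (1 / real a ^ 2) * real N) at_top sequentially"
      using a2 by (intro filterlim_tendsto_pos_mult_at_top[OF tendsto_const] filterlim_real_sequentially) auto
    then have "filterlim (\<lambda>N. real N / real a ^ 2) at_top sequentially" by simp
    moreover have "((\<lambda>x. Q x / x) \<longlongrightarrow> q) at_top"
      using has_dens_H_le[of 1] unfolding has_dens_def Q_def q_def .
    ultimately have "(\<lambda>N. Q (real N / real a ^ 2) / (real N / real a ^ 2)) \<longlonglongrightarrow> q"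
      by (rule filterlim_compose[rotated])
    then have "(\<lambda>N. Q (real N / real a ^ 2) / (real N / real a ^ 2) / real a ^ 2) \<longlonglongrightarrow> q / real a ^ 2"
      using a2 by (intro tendsto_divide tendsto_const) auto
    moreover have "Q (real N / real a ^ 2) / (real N / real a ^ 2) / real a ^ 2 = Q (real N / real a ^ 2) / real N" for N
      using a by simp
    ultimately show ?thesis by simp
  qed
  define f where "f = (\<lambda>K N. \<Sum>a\<in>{1..K}. Q (real N / real a ^ 2) / real N)"
  have lim: "f K \<longlonglongrightarrow> q * z K" for K
  proof -
    have "f K \<longlonglongrightarrow> (\<Sum>a\<in>{1..K}. q / real a ^ 2)"
      unfolding f_def by (intro tendsto_sum term_lim) auto
    then show ?thesis by (simp add: z_def sum_distrib_left)
  qed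
  have f1: "f N N = 1" if "N \<ge> 1" for N
    using sum_cnt_squarefree[of N] that unfolding f_def Q_def by (simp flip: sum_divide_distrib)
  have Q0: "Q x \<ge> 0" for x unfolding Q_def by simp
  have le1: "q * z K \<le> 1" for K
  proof (rule LIMSEQ_le_const2[OF lim], intro exI[of _ "max 1 K"] allI impI)
    fix N assume N: "N \<ge> max 1 K"
    have "f K N \<le> f N N" unfolding f_def using N Q0 by (intro sum_mono2) auto
    then show "f K N \<le> 1" using f1 N by simp
  qed
  have ge1: "1 \<le> q * z K + 1 / real K" if K: "K \<ge> 1" for K
  proof (rule LIMSEQ_le_const[where X = "\<lambda>N. f K N + 1 / real K"])
    show "(\<lambda>N. f K N + 1 / real K) \<longlonglongrightarrow> q * z K + 1 / real K" by (intro tendsto_add lim tendsto_const)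
    show "\<exists>N0. \<forall>N\<ge>N0. 1 \<le> f K N + 1 / real K"
    proof (intro exI[of _ K] allI impI)
      fix N assume N: "N \<ge> K"
      have "{1..N} = {1..K} \<union> {Suc K..N}" using N K by auto
      then have "f N N = f K N + (\<Sum>a\<in>{Suc K..N}. Q (real N / real a ^ 2) / real N)"
        unfolding f_def by (simp add: sum.union_disjoint)
      also have "(\<Sum>a\<in>{Suc K..N}. Q (real N / real a ^ 2) / real N) \<le> (\<Sum>a\<in>{Suc K..N}. 1 / real a ^ 2)"
      proof (rule sum_mono)
        fix a
        have "Q (real N / real a ^ 2) \<le> real N / real a ^ 2" unfolding Q_def by (rule cnt_le) simp
        then have "Q (real N / real a ^ 2) / real N \<le> real N / real a ^ 2 / real N"
          by (rule divide_right_mono) simp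
        also have "\<dots> = 1 / real a ^ 2" using N K by simp
        finally show "Q (real N / real a ^ 2) / real N \<le> 1 / real a ^ 2" .
      qed
      also have "\<dots> \<le> 1 / real K" using sum_inverse_powers_le[of "Suc K" 2 N] K by simp
      finally show "1 \<le> f K N + 1 / real K" using f1[of N] N K by simp
    qed
  qed
  have zlim: "z \<longlonglongrightarrow> pi ^ 2 / 6"
  proof -
    have "z = (\<lambda>K. \<Sum>n<K. 1 / (real n + 1) ^ 2)"
      unfolding z_def by (rule ext) (simp add: sum.atLeast1_atMost_eq add.commute)
    then show ?thesis using inverse_squares_sums unfolding sums_def by (simp add: add.commute)
  qed
  have "q * (pi ^ 2 / 6) \<le> 1"
    by (rule LIMSEQ_le_const2[OF tendsto_mult[OF tendsto_const zlim]]) (use le1 in auto)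
  moreover have "1 \<le> q * (pi ^ 2 / 6) + 0"
  proof (rule LIMSEQ_le_const[where X = "\<lambda>K. q * z K + 1 / real K"])
    show "(\<lambda>K. q * z K + 1 / real K) \<longlonglongrightarrow> q * (pi ^ 2 / 6) + 0"
      by (intro tendsto_add tendsto_mult tendsto_const zlim lim_1_over_n)
    show "\<exists>N. \<forall>K\<ge>N. 1 \<le> q * z K + 1 / real K" using ge1 by blast
  qed
  ultimately have "q * (pi ^ 2 / 6) = 1" by simp
  then show ?thesis unfolding q_def by (simp add: field_simps)
qed

section \<open>Numerical evaluation of the constant\<close>

text \<open>Below \<open>5 ^ 2\<close> the only prime squares are 4 and 9, so \<open>a\<close> is
  squarefree or exceptional.\<close>

lemma H_le_1_small:
  assumes "a < 25" "\<not> 4 dvd a" "\<not> 9 dvd a"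
  shows "H a \<le> 1"
proof (rule ccontr)
  assume "\<not> H a \<le> 1"
  moreover have a: "a > 0" using assms(2) by (cases a) auto
  ultimately obtain q where q: "prime q" "1 \<le> H (multiplicity q a)"
    using Suc_le_H_iff[of a 1] by auto
  then have "multiplicity q a \<ge> 2" using H_pos_iff[of "multiplicity q a"] by linarith
  then have dvd: "q ^ 2 dvd a" by (rule multiplicity_dvd')
  then have "q ^ 2 \<le> a" using a by (rule dvd_imp_le)
  then have "q ^ 2 < 5 ^ 2" using assms(1) by simp
  then have "q < 5" by (rule power_less_imp_less_base) simp
  then have "q \<in> {0, 1, 2, 3, 4}" by auto
  moreover have "q \<noteq> 0" "q \<noteq> 1" "q \<noteq> 4" using q(1) by (intro notI; simp)+
  ultimately show False using dvd assms by auto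
qed

text \<open>The telescoping difference is the integral of \<open>t ^ (-4)\<close> over the unit
  interval centred at \<open>m\<close>, which exceeds \<open>1 / m ^ 4\<close> by convexity. For
  \<open>M = 61\<close> this is about a third of what \<open>sum_inverse_powers_le\<close> gives, a
  gain on which \<open>c1 < 1.814\<close> depends.\<close>

lemma sum_inverse_fourth_powers_le:
  assumes "M \<ge> 1"
  shows "(\<Sum>m=M..K. 1 / real m ^ 4) \<le> 1 / (3 * (real M - 1 / 2) ^ 3)"
proof (cases "K \<ge> M")
  case True
  have step: "1 / m ^ 4 \<le> 1 / (3 * (m - 1 / 2) ^ 3) - 1 / (3 * (m + 1 / 2) ^ 3)" if m: "m \<ge> 1" for m :: real
  proof -
    have 1: "(m - 1 / 2) * (m + 1 / 2) > 0" using m by simp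
    have 2: "m - 1 / 2 > 0" "m + 1 / 2 > 0" using m by auto
    have le: "((m - 1 / 2) * (m + 1 / 2)) ^ 3 \<le> m ^ 4 * (m ^ 2 + 1 / 12)"
    proof -
      have "((m - 1 / 2) * (m + 1 / 2)) ^ 3 \<le> (m ^ 2) ^ 2 * (m ^ 2)"
      proof -
        have "(m - 1 / 2) * (m + 1 / 2) \<le> m ^ 2" by (simp add: algebra_simps power2_eq_square)
        then have "((m - 1 / 2) * (m + 1 / 2)) ^ 3 \<le> (m ^ 2) ^ 3" using 1 by (intro power_mono) auto
        then show ?thesis by (simp flip: power_mult power_add)
      qed
      also have "\<dots> = m ^ 4 * m ^ 2" by (simp flip: power_mult)
      also have "\<dots> \<le> m ^ 4 * (m ^ 2 + 1 / 12)" by (intro mult_left_mono) auto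
      finally show ?thesis .
    qed
    have "1 / (3 * (m - 1 / 2) ^ 3) - 1 / (3 * (m + 1 / 2) ^ 3) =
          (m ^ 2 + 1 / 12) / ((m - 1 / 2) * (m + 1 / 2)) ^ 3"
      using 2 by (simp add: divide_simps power_mult_distrib) (simp add: algebra_simps power2_eq_square power3_eq_cube)
    also have "\<dots> \<ge> 1 / m ^ 4"
      using le 1 m by (subst divide_le_eq) (auto simp: field_simps)
    finally show ?thesis .
  qed
  have "(\<Sum>m=M..K. 1 / real m ^ 4) \<le> 1 / (3 * (real M - 1 / 2) ^ 3) - 1 / (3 * (real K + 1 / 2) ^ 3)"
    using True
  proof (induction K rule: dec_induct)
    case base
    then show ?case using step[of "real M"] assms by simp
  next
    case (step K)
    then show ?case using \<open>\<And>m. 1 \<le> m \<Longrightarrow> _\<close>[of "real (Suc K)"] by (simp add: add.commute)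
  qed
  moreover have "0 \<le> 1 / (3 * (real K + 1 / 2) ^ 3)" by simp
  ultimately show ?thesis by linarith
next
  case False
  then show ?thesis using assms by simp
qed

section \<open>Enclosing the density of height at most 2\<close>

lemma prime_less_61:
  assumes "prime p" "p < (61::nat)"
  shows "p \<in> {2,3,5,7,11,13,17,19,23,29,31,37,41,43,47,53,59}"
proof -
  have "p \<in> set [2..<61]" unfolding set_upt using assms prime_ge_2_nat[of p] by auto
  moreover have "\<forall>p\<in>set [2..<61]. prime (p::nat) \<longrightarrow> p \<in> {2,3,5,7,11,13,17,19,23,29,31,37,41,43,47,53,59}"
    by simp
  ultimately show ?thesis using assms(1) by blast
qed

text \<open>Exponents of height at most 1 at all primes below 61 give height at most 2, unless a
  prime from 61 on occurs to a power of at least 4; the latter numbers are removed by a union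
  bound.\<close>

lemma Hdens_2_lower: "0.95592181 \<le> Hdens 2"
proof -
  let ?S = "{2,3,5,7,11,13,17,19,23,29,31,37,41,43,47,53,59} :: nat set"
  \<comment> \<open>The exponent 0 and small squarefree exponents. Cutting off larger admissible
    ones only shrinks \<open>A\<close>; for \<open>p = 2\<close> the cutoff is higher because powers
    of 2 decay most slowly.\<close>
  define F :: "nat \<Rightarrow> nat set" where
    "F = (\<lambda>p. {0,1,2,3,5,6,7,10,11,13,14,15} \<union> (if p = 2 then {17,19,21,22,23} else {}))"
  define c where "c = (\<lambda>p. \<Sum>i\<in>F p. 1 / real p ^ i - 1 / real p ^ (i + 1))"
  define A where "A = {n. \<forall>p\<in>?S. multiplicity p n \<in> F p}"
  have F: "H a \<le> 1" if "a \<in> F p" for a p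
  proof (cases "a = 0")
    case False
    with that have "a < 25" "\<not> 4 dvd a" "\<not> 9 dvd a" unfolding F_def by (auto split: if_splits)
    then show ?thesis by (rule H_le_1_small)
  qed simp
  have dA: "has_dens A (\<Prod>p\<in>?S. c p)"
    unfolding A_def c_def by (intro has_dens_exponents local_dens_finite) (auto simp: F_def)
  have sub: "n \<in> {n. H n \<le> 2} \<union> {n. \<exists>m\<ge>61. m ^ 4 dvd n}" if n: "n \<ge> 1" "n \<in> A" for n
  proof (cases "H n \<le> 2")
    case False
    then obtain p where p: "prime p" "2 \<le> H (multiplicity p n)"
      using Suc_le_H_iff[of n 2] n by auto
    then have "multiplicity p n \<notin> F p" using F[of "multiplicity p n" p] by auto
    then have "p \<notin> ?S" using n(2) unfolding A_def by blast
    then have "p \<ge> 61" using prime_less_61[OF p(1)] by (meson not_le)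
    moreover have "multiplicity p n > 0" using p(2) by (cases "multiplicity p n") auto
    then have "tet 2 2 \<le> multiplicity p n" using p(2) by (rule tet_le_of_le_H)
    then have "p ^ 4 dvd n" by (intro multiplicity_dvd') (simp add: numeral_2_eq_2)
    ultimately show ?thesis by auto
  qed simp
  have cnt: "cnt A x \<le> cnt {n. H n \<le> 2} x + 1 / (3 * (121 / 2) ^ 3) * x" if x: "x \<ge> 1" for x
  proof -
    have "cnt A x \<le> cnt ({n. H n \<le> 2} \<union> {n. \<exists>m\<ge>61. m ^ 4 dvd n}) x"
      by (rule cnt_mono) (use sub in blast)
    also have "\<dots> \<le> cnt {n. H n \<le> 2} x + cnt {n. \<exists>m\<ge>61. m ^ 4 dvd n} x" by (rule cnt_Un_le)
    also have "cnt {n. \<exists>m\<ge>61. m ^ 4 dvd n} x \<le> 1 / (3 * (121 / 2) ^ 3) * x"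
    proof (rule cnt_power_multiples_le)
      show "(\<Sum>m=61..K. 1 / real m ^ 4) \<le> 1 / (3 * (121 / 2) ^ 3)" for K
        using sum_inverse_fourth_powers_le[of 61 K] by simp
    qed (use x in auto)
    finally show ?thesis by simp
  qed
  have upper: "(\<Prod>p\<in>?S. c p) \<le> Hdens 2 + 1 / (3 * (121 / 2) ^ 3)"
    using has_dens_le[OF dA has_dens_H_le[of 2]] cnt by blast
  have tail: "1 / (3 * (121 / 2) ^ 3) \<le> (0.0000015053 :: real)" by (simp add: power3_eq_cube)
  have main: "0.955923316 \<le> (\<Prod>p\<in>?S. c p)"
  proof -
    \<comment> \<open>Nine-digit lower bounds for the local factors \<open>c p\<close>, so that the
      product is evaluated on short decimals.\<close>
    define r :: "nat \<Rightarrow> real" where "r = (\<lambda>p. if p = 2 then 0.965688169 else if p = 3 then 0.991632788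
      else if p = 5 then 0.998717539 else if p = 7 then 0.999642835 else if p = 11 then 0.999937903
      else if p = 13 then 0.999967679 else if p = 17 then 0.999988731 else if p = 19 then 0.999992730
      else if p = 23 then 0.999996581 else if p = 29 then 0.999998634 else if p = 31 then 0.999998952
      else if p = 37 then 0.999999480 else if p = 41 then 0.999999654 else if p = 43 then 0.999999714
      else if p = 47 then 0.999999799 else if p = 53 then 0.999999875 else 0.999999918)"
    have "0.955923316 \<le> (\<Prod>p\<in>?S. r p)" unfolding r_def by simp
    also have "\<dots> \<le> (\<Prod>p\<in>?S. c p)"
    proof (rule prod_mono)
      fix p assume "p \<in> ?S"
      then show "0 \<le> r p \<and> r p \<le> c p"
        unfolding r_def c_def F_def by (elim insertE emptyE) simp_all
    qed
    finally show ?thesis .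
  qed
  have "0.95592181 \<le> (0.955923316 - 0.0000015053 :: real)" by simp
  also have "\<dots> \<le> (\<Prod>p\<in>?S. c p) - 1 / (3 * (121 / 2) ^ 3)"
    by (rule diff_mono[OF main tail])
  also have "\<dots> \<le> Hdens 2" using upper by (simp only: diff_le_eq)
  finally show ?thesis .
qed

text \<open>Forbidding only some non-squarefree exponents, at the six smallest primes, describes a
  larger set, whose density is a finite product.\<close>

lemma Hdens_2_upper: "Hdens 2 \<le> 0.955952"
proof -
  let ?S = "{2,3,5,7,11,13} :: nat set"
  define B :: "nat \<Rightarrow> nat set" where "B = (\<lambda>p. {4, 8, 9} \<union> (if p = 2 then {12, 16} else {}))"
  define c where "c = (\<lambda>p. 1 - (\<Sum>i\<in>B p. 1 / real p ^ i - 1 / real p ^ (i + 1)))"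
  have dA: "has_dens {n. \<forall>p\<in>?S. multiplicity p n \<in> - B p} (\<Prod>p\<in>?S. c p)"
    unfolding c_def by (intro has_dens_exponents local_dens_Compl local_dens_finite) (auto simp: B_def)
  have bad: "2 \<le> H a" if "a \<in> B p" for a p
  proof -
    have "a > 0" "2 ^ 2 dvd a \<or> 3 ^ 2 dvd a" using that unfolding B_def by (auto split: if_splits)
    then have "\<not> squarefree a"
      by (metis not_squarefreeI nat_dvd_1_iff_1 numeral_eq_one_iff semiring_norm(85,86))
    then show ?thesis using H_le_1_iff_squarefree[OF \<open>a > 0\<close>] by linarith
  qed
  have "Hdens 2 \<le> (\<Prod>p\<in>?S. c p)"
  proof (rule has_dens_mono[OF has_dens_H_le dA])
    fix n :: nat assume n: "n \<ge> 1" "n \<in> {n. H n \<le> 2}"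
    then have "\<not> Suc 2 \<le> H n" by simp
    then have *: "\<And>p. prime p \<Longrightarrow> \<not> 2 \<le> H (multiplicity p n)"
      using Suc_le_H_iff[of n 2] n by auto
    have "multiplicity p n \<in> - B p" if "p \<in> ?S" for p
    proof -
      have "prime p" using that by auto
      then show ?thesis using *[of p] bad[of "multiplicity p n" p] by blast
    qed
    then show "n \<in> {n. \<forall>p\<in>?S. multiplicity p n \<in> - B p}" by blast
  qed
  also have "\<dots> \<le> 0.955952" unfolding c_def B_def by simp
  finally show ?thesis .
qed

lemma Hdens_1_bounds: "0.6079271 \<le> Hdens 1" "Hdens 1 \<le> 0.60792711"
proof -
  have "pi ^ 2 \<le> 3.1415926535899 ^ 2" using pi_approx(2) by (intro power_mono) auto
  then have "0.6079271 * pi ^ 2 \<le> 0.6079271 * 3.1415926535899 ^ 2" by (rule mult_left_mono) simp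
  also have "\<dots> \<le> (6::real)" by (simp add: power2_eq_square)
  finally show "0.6079271 \<le> Hdens 1" unfolding Hdens_1 by (subst pos_le_divide_eq) simp_all
  have "3.141592653588 ^ 2 \<le> pi ^ 2" using pi_approx(1) by (intro power_mono) auto
  then have "0.60792711 * 3.141592653588 ^ 2 \<le> 0.60792711 * pi ^ 2" by (rule mult_left_mono) simp
  moreover have "(6::real) \<le> 0.60792711 * 3.141592653588 ^ 2" by (simp add: power2_eq_square)
  ultimately have "6 \<le> 0.60792711 * pi ^ 2" by (rule order_trans[rotated])
  then show "Hdens 1 \<le> 0.60792711" unfolding Hdens_1 by (subst pos_divide_le_eq) simp_all
qed

lemma tet_2_3: "tet 2 3 = 16"
  by (simp add: numeral_3_eq_3)

lemma Hdens_3_bounds: "1 - Hdens 3 \<le> 0.000007645166" "0.00000764488 \<le> 1 - Hdens 3"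
proof -
  have "1 - Hdens 3 \<le> 1 / 2 / 2 ^ 16 + 1 / 2 ^ (2 * 16) + 2 / 3 / 3 ^ 16 + 1 / 3 ^ (2 * 16) + 25 / 4 / 5 ^ 16"
    using Hdens_compl_upper[of 3] unfolding tet_2_3 by simp
  also have "\<dots> \<le> 0.000007645166" by simp
  finally show "1 - Hdens 3 \<le> 0.000007645166" .
  have "0.00000764488 \<le> 1 - (1 - 1 / 2 / 2 ^ 16) * (1 - 2 / 3 / 3 ^ 16 :: real)" by simp
  also have "\<dots> \<le> 1 - Hdens 3" using Hdens_compl_lower[of 3] unfolding tet_2_3 by simp
  finally show "0.00000764488 \<le> 1 - Hdens 3" .
qed

text \<open>Summation by parts of the first four terms: \<open>1 - Hdens k\<close> acquires the
  weight \<open>tet 2 (Suc k) - tet 2 k\<close>, which is 12 for \<open>k = 2\<close> and 65520 for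
  \<open>k = 3\<close>.\<close>

lemma c1_eq_Hdens:
  "c1 = 2 - 2 * Hdens 1 + 12 * (1 - Hdens 2) + 65520 * (1 - Hdens 3)
      - 65536 * (1 - Hdens 4) + (\<Sum>j. dev (j + 4))"
proof -
  have "{..<4::nat} = {0, 1, 2, 3}" by auto
  then have c1: "c1 = dev 0 + dev 1 + dev 2 + dev 3 + (\<Sum>j. dev (j + 4))"
    using c1_eq[of 4] by simp
  have d0: "dev 0 = 2 * Hdens 1 - 1 / 2" unfolding dev_eq by (simp add: Hdens_def)
  have d1: "dev 1 = 4 * (Hdens 2 - Hdens 1) - 1 / 2"
    unfolding dev_eq by (simp add: numeral_2_eq_2)
  have "tet 2 2 = 4" by (simp add: numeral_2_eq_2)
  then have d2: "dev 2 = 16 * (Hdens 3 - Hdens 2) - 1 / 2" unfolding dev_eq by simp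
  have d3: "dev 3 = 65536 * ((1 - Hdens 3) - (1 - Hdens 4)) - 1 / 2"
    unfolding dev_eq tet_2_3 by simp
  show ?thesis unfolding c1 d0 d1 d2 d3 by (simp add: algebra_simps)
qed

text \<open>The upper bound is the delicate one: the enclosures give about 1.813995, less than
  0.00001 below the target, while the lower bound has about 0.0006 to spare.\<close>

lemma c1_bounds: "1.813 \<le> c1" "c1 < 1.814"
proof -
  define T where "T = tet 2 4"
  have "tet 2 (Suc 3) = 2 ^ tet 2 3" by (rule tet.simps)
  then have "T = 65536" unfolding T_def tet_2_3 by simp
  then have T: "T \<ge> 100" by simp
  define t where "t = (\<Sum>j. dev (j + 4))"
  have "\<bar>t\<bar> \<le> 3 * 10 * (2 / 3) ^ tet 2 4"
    unfolding t_def by (rule sums_dev_tail_bound(2)) (auto intro: abs_dev_le)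
  \<comment> \<open>The true exponent is 65536; 100 is ample and keeps the powers small enough to
    evaluate.\<close>
  also have "\<dots> \<le> 3 * 10 * (2 / 3) ^ 100"
    unfolding T_def[symmetric] using T by (intro mult_left_mono power_decreasing) auto
  also have "\<dots> \<le> 0.000000001" by (simp add: power_divide)
  finally have t: "\<bar>t\<bar> \<le> 0.000000001" .
  have "1 - Hdens 4 \<le> 4 / 2 ^ T" unfolding T_def by (rule Hdens_compl_le) simp
  also have "\<dots> \<le> 4 / 2 ^ 100"
    using T by (intro divide_left_mono power_increasing) auto
  also have "\<dots> \<le> 0.00000000000001" by simp
  finally have u4: "1 - Hdens 4 \<le> 0.00000000000001" .
  have u4': "0 \<le> 1 - Hdens 4" using Hdens_le_1[of 4] by simp
  note c1 = c1_eq_Hdens[folded t_def]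
  show "1.813 \<le> c1"
    using c1 t u4 Hdens_3_bounds(2) Hdens_1_bounds(2) Hdens_2_upper by (simp add: abs_le_iff)
  show "c1 < 1.814"
    using c1 t u4' Hdens_3_bounds(1) Hdens_1_bounds(1) Hdens_2_lower by (simp add: abs_le_iff)
qed

theorem theorem2:
  shows "(\<exists>C. \<forall>x::real. x \<ge> 2 \<longrightarrow>
            \<bar>calH x - (x * real (logstar x) / 2 + c1 * x + H1 x)\<bar>
              \<le> C * sqrt x * ln x powr (9/4))
       \<and> summable (\<lambda>k. real (tet 2 (Suc k)) * Ddens (Suc k) - 1/2)
       \<and> 1.813 \<le> c1 \<and> c1 < 1.814
       \<and> (\<exists>C. \<forall>x::real. x \<ge> 2 \<longrightarrow> \<bar>H1 x\<bar> \<le> C * x)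
       \<and> (\<exists>C. \<forall>N::nat. \<forall>x::real. x = real (tet 2 N) - 1 \<longrightarrow> x \<ge> 2 \<longrightarrow>
            \<bar>H1 x\<bar> \<le> C * sqrt x * ln x powr (9/4))
       \<and> (\<exists>C. \<forall>N::nat. \<forall>x::real. x = real (tet 2 N) \<longrightarrow> x \<ge> 2 \<longrightarrow>
            \<bar>H1 x - x / 2\<bar> \<le> C * x powr (2 - ln 3 / ln 2))"
  using calH_asymptotics summable_dev[unfolded dev_def[abs_def]] c1_bounds H1_linear_bound
    H1_before_tet_bound H1_at_tet_bound
  by (intro conjI)

end
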